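(* Assume the standing hypotheses below, including $(A_c^+)$, and let $\Lambda_2>0$. Then there is a constant $C=C(n,p,\nu_1,\Omega,\Lambda_2,\|c\|_{L^p(\Omega)},\|h^-\|_{L^p(\Omega)})$, where $\nu_1=\mu_1\vartheta$, such that for every $\lambda\in[0,\Lambda_2]$, every supersolution $u$ of $(P_\lambda)$ satisfies $\|u^-\|_{L^\infty(\Omega)}\le C$.
   Context: Standing hypotheses: $\Omega\subset\mathbb R^n$, $n\ge3$, is a bounded domain with boundary of class $C^{1,\mathrm{Dini}}$. $A(x)=(a_{ij}(x))$ is a symmetric matrix with entries in $C^{0,\mathrm{Dini}}(\overline\Omega)$ and $\vartheta I_n\le A(x)\le\vartheta^{-1}I_n$ for some $\vartheta>0$. $M(x)$ is a measurable symmetric matrix with $0<\mu_1I_n\le M(x)\le\mu_2I_n$ in $\Omega$. $c,h\in L^p(\Omega)$ for some $p>n$; $c^+=\max(c,0)$, $c^-=\max(-c,0)$, $h^-=\max(-h,0)$, and $c_\lambda(x):=\lambda c^+(x)-c^-(x)$. Hypothesis $(A_c^+)$: $\Omega_{c^+}:=\operatorname{supp}(c^+)$ has $|\Omega_{c^+}|>0$, and there is $\varepsilon>0$ such that $c^-=0$ a.e. in $\{x\in\Omega: d(x,\Omega_{c^+})<\varepsilon\}$. A supersolution of $(P_\lambda)$ is $u\in H^1(\Omega)\cap L^\infty(\Omega)$ with $u^-\in H^1_0(\Omega)$ satisfying $\int_\Omega A Du\cdot D\varphi\ge\int_\Omega c_\lambda u\varphi+\int_\Omega\varphi(MDu,Du)+\int_\Omega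 h\varphi$ for all nonnegative $\varphi\in C_0^\infty(\Omega)$. *)

theory Defs
  imports "HOL-Analysis.Analysis"
begin

definition pos_part :: "real \<Rightarrow> real" where "pos_part t = max t 0"
definition neg_part :: "real \<Rightarrow> real" where "neg_part t = max (- t) 0"

definition dini_continuous_on :: "'a::metric_space set \<Rightarrow> ('a \<Rightarrow> 'b::metric_space) \<Rightarrow> bool" where
  "dini_continuous_on S f \<longleftrightarrow>
     (\<exists>\<omega>::real \<Rightarrow> real. mono_on {0..} \<omega> \<and> (\<omega> \<longlongrightarrow> 0) (at_right 0) \<and>
        (\<forall>x\<in>S. \<forall>y\<in>S. dist (f x) (f y) \<le> \<omega> (dist x y)) \<and>
        set_integrable lborel {0<..1} (\<lambda>t. \<omega> t / t))"

text \<open>C^infinity: all iterated partial derivatives exist everywhere; D is the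
  family of iterated partial derivatives indexed by lists of coordinate directions.\<close>
definition smooth_fun :: "(real^'n \<Rightarrow> real) \<Rightarrow> bool" where
  "smooth_fun f \<longleftrightarrow> (\<exists>D :: 'n list \<Rightarrow> real^'n \<Rightarrow> real. D [] = f \<and>
      (\<forall>is x. (D is has_derivative (\<lambda>v. \<Sum>j\<in>UNIV. D (j # is) x * v $ j)) (at x)))"

definition test_fun :: "(real^'n) set \<Rightarrow> (real^'n \<Rightarrow> real) \<Rightarrow> bool" where
  "test_fun \<Omega> \<phi> \<longleftrightarrow> smooth_fun \<phi> \<and> compact (closure {x. \<phi> x \<noteq> 0}) \<and>
      closure {x. \<phi> x \<noteq> 0} \<subseteq> \<Omega>"

definition Lp :: "(real^'n) set \<Rightarrow> real \<Rightarrow> (real^'n \<Rightarrow> real) \<Rightarrow> bool" where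
  "Lp \<Omega> p f \<longleftrightarrow> f \<in> borel_measurable (lebesgue_on \<Omega>) \<and>
      integrable (lebesgue_on \<Omega>) (\<lambda>x. \<bar>f x\<bar> powr p)"

definition Lp_norm :: "(real^'n) set \<Rightarrow> real \<Rightarrow> (real^'n \<Rightarrow> real) \<Rightarrow> real" where
  "Lp_norm \<Omega> p f = (\<integral>x. \<bar>f x\<bar> powr p \<partial>lebesgue_on \<Omega>) powr (1 / p)"

definition Linf :: "(real^'n) set \<Rightarrow> (real^'n \<Rightarrow> real) \<Rightarrow> bool" where
  "Linf \<Omega> f \<longleftrightarrow> f \<in> borel_measurable (lebesgue_on \<Omega>) \<and>
      (\<exists>C. AE x in lebesgue_on \<Omega>. \<bar>f x\<bar> \<le> C)"

definition Linf_norm :: "(real^'n) set \<Rightarrow> (real^'n \<Rightarrow> real) \<Rightarrow> real" where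
  "Linf_norm \<Omega> f = Inf {C. AE x in lebesgue_on \<Omega>. \<bar>f x\<bar> \<le> C}"

definition weak_grad :: "(real^'n) set \<Rightarrow> (real^'n \<Rightarrow> real) \<Rightarrow> (real^'n \<Rightarrow> real^'n) \<Rightarrow> bool" where
  "weak_grad \<Omega> u G \<longleftrightarrow>
     (\<forall>\<phi> g i. test_fun \<Omega> \<phi> \<longrightarrow> (\<forall>x. (\<phi> has_derivative (\<lambda>v. g x \<bullet> v)) (at x)) \<longrightarrow>
        (\<integral>x. u x * g x $ i \<partial>lebesgue_on \<Omega>) = - (\<integral>x. G x $ i * \<phi> x \<partial>lebesgue_on \<Omega>))"

definition H1_grad :: "(real^'n) set \<Rightarrow> (real^'n \<Rightarrow> real) \<Rightarrow> (real^'n \<Rightarrow> real^'n) \<Rightarrow> bool" where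
  "H1_grad \<Omega> u G \<longleftrightarrow> Lp \<Omega> 2 u \<and> (\<forall>i. Lp \<Omega> 2 (\<lambda>x. G x $ i)) \<and> weak_grad \<Omega> u G"

definition H1 :: "(real^'n) set \<Rightarrow> (real^'n \<Rightarrow> real) \<Rightarrow> bool" where
  "H1 \<Omega> u \<longleftrightarrow> (\<exists>G. H1_grad \<Omega> u G)"

definition H10 :: "(real^'n) set \<Rightarrow> (real^'n \<Rightarrow> real) \<Rightarrow> bool" where
  "H10 \<Omega> v \<longleftrightarrow> (\<exists>G. H1_grad \<Omega> v G \<and>
     (\<exists>\<phi>s gs. (\<forall>k. test_fun \<Omega> (\<phi>s k) \<and> (\<forall>x. (\<phi>s k has_derivative (\<lambda>w. gs k x \<bullet> w)) (at x))) \<and>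
        (\<lambda>k. \<integral>x. (\<phi>s k x - v x)\<^sup>2 \<partial>lebesgue_on \<Omega>) \<longlonglongrightarrow> 0 \<and>
        (\<lambda>k. \<integral>x. (norm (gs k x - G x))\<^sup>2 \<partial>lebesgue_on \<Omega>) \<longlonglongrightarrow> 0))"

definition bounded_domain :: "(real^'n) set \<Rightarrow> bool" where
  "bounded_domain \<Omega> \<longleftrightarrow> open \<Omega> \<and> connected \<Omega> \<and> bounded \<Omega> \<and> \<Omega> \<noteq> {}"

text \<open>C^{1,Dini} boundary: near each boundary point, after a rigid motion, Omega is
  the supergraph in direction k of a C^1 function gamma (independent of the k-th
  coordinate) whose gradient g is Dini continuous.\<close>
definition C1_Dini_boundary :: "(real^'n) set \<Rightarrow> bool" where
  "C1_Dini_boundary \<Omega> \<longleftrightarrow>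
    (\<forall>x0\<in>frontier \<Omega>. \<exists>r>0. \<exists>Q k (\<gamma>::real^'n \<Rightarrow> real) g.
        orthogonal_transformation Q \<and>
        (\<forall>y. \<gamma> y = \<gamma> (\<chi> i. if i = k then 0 else y $ i)) \<and>
        (\<forall>y\<in>ball 0 r. (\<gamma> has_derivative (\<lambda>v. g y \<bullet> v)) (at y)) \<and>
        dini_continuous_on (ball 0 r) g \<and>
        (\<forall>y\<in>ball x0 r. y \<in> \<Omega> \<longleftrightarrow> Q (y - x0) $ k > \<gamma> (Q (y - x0))))"

definition c_lambda :: "real \<Rightarrow> (real^'n \<Rightarrow> real) \<Rightarrow> real^'n \<Rightarrow> real" where
  "c_lambda lam c x = lam * pos_part (c x) - neg_part (c x)"

definition supersolution ::
  "(real^'n) set \<Rightarrow> (real^'n \<Rightarrow> real^'n^'n) \<Rightarrow> (real^'n \<Rightarrow> real^'n^'n) \<Rightarrow>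
   (real^'n \<Rightarrow> real) \<Rightarrow> (real^'n \<Rightarrow> real) \<Rightarrow> real \<Rightarrow> (real^'n \<Rightarrow> real) \<Rightarrow> bool" where
  "supersolution \<Omega> A M c h lam u \<longleftrightarrow>
     H1 \<Omega> u \<and> Linf \<Omega> u \<and> H10 \<Omega> (\<lambda>x. neg_part (u x)) \<and>
     (\<exists>G. H1_grad \<Omega> u G \<and>
       (\<forall>\<phi> g. test_fun \<Omega> \<phi> \<longrightarrow> (\<forall>x. 0 \<le> \<phi> x) \<longrightarrow>
          (\<forall>x. (\<phi> has_derivative (\<lambda>v. g x \<bullet> v)) (at x)) \<longrightarrow>
          (\<integral>x. (A x *v G x) \<bullet> g x \<partial>lebesgue_on \<Omega>) \<ge>
            (\<integral>x. c_lambda lam c x * u x * \<phi> x \<partial>lebesgue_on \<Omega>)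
          + (\<integral>x. \<phi> x * ((M x *v G x) \<bullet> G x) \<partial>lebesgue_on \<Omega>)
          + (\<integral>x. h x * \<phi> x \<partial>lebesgue_on \<Omega>)))"

definition ess_supp :: "(real^'n) set \<Rightarrow> (real^'n \<Rightarrow> real) \<Rightarrow> (real^'n) set" where
  "ess_supp \<Omega> f = {x. \<forall>r>0. \<not> (AE y in lebesgue_on (\<Omega> \<inter> ball x r). f y = 0)}"

definition A_c_plus :: "(real^'n) set \<Rightarrow> (real^'n \<Rightarrow> real) \<Rightarrow> bool" where
  "A_c_plus \<Omega> c \<longleftrightarrow>
     (let S = ess_supp \<Omega> (\<lambda>x. pos_part (c x)) in
       emeasure lebesgue S > 0 \<and>
       (\<exists>\<epsilon>>0. AE x in lebesgue_on {x\<in>\<Omega>. infdist x S < \<epsilon>}. neg_part (c x) = 0))"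

definition standing_coeffs ::
  "(real^'n) set \<Rightarrow> real \<Rightarrow> (real^'n \<Rightarrow> real^'n^'n) \<Rightarrow> real \<Rightarrow> (real^'n \<Rightarrow> real^'n^'n) \<Rightarrow>
   real \<Rightarrow> real \<Rightarrow> (real^'n \<Rightarrow> real) \<Rightarrow> (real^'n \<Rightarrow> real) \<Rightarrow> bool" where
  "standing_coeffs \<Omega> p A \<theta> M \<mu>1 \<mu>2 c h \<longleftrightarrow>
     \<theta> > 0 \<and>
     (\<forall>i j. continuous_on (closure \<Omega>) (\<lambda>x. A x $ i $ j) \<and>
            dini_continuous_on (closure \<Omega>) (\<lambda>x. A x $ i $ j)) \<and>
     (\<forall>x\<in>closure \<Omega>. transpose (A x) = A x) \<and>
     (\<forall>x\<in>closure \<Omega>. \<forall>\<xi>. \<theta> * (norm \<xi>)\<^sup>2 \<le> \<xi> \<bullet> (A x *v \<xi>) \<and>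
                          \<xi> \<bullet> (A x *v \<xi>) \<le> (1 / \<theta>) * (norm \<xi>)\<^sup>2) \<and>
     0 < \<mu>1 \<and>
     (\<forall>i j. (\<lambda>x. M x $ i $ j) \<in> borel_measurable (lebesgue_on \<Omega>)) \<and>
     (\<forall>x\<in>\<Omega>. transpose (M x) = M x) \<and>
     (\<forall>x\<in>\<Omega>. \<forall>\<xi>. \<mu>1 * (norm \<xi>)\<^sup>2 \<le> \<xi> \<bullet> (M x *v \<xi>) \<and>
                     \<xi> \<bullet> (M x *v \<xi>) \<le> \<mu>2 * (norm \<xi>)\<^sup>2) \<and>
     Lp \<Omega> p c \<and> Lp \<Omega> p h"

end

theory Submission
  imports Defs
begin

text \<open>
  Write \<open>U = u\<^sup>-\<close>.  Where \<open>U > 0\<close> we have \<open>Du = -DU\<close>, so testing with \<open>\<psi>(U)\<close>, \<open>\<psi>\<close> nondecreasing and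
  vanishing on \<open>t \<le> k\<close>, makes the term with \<open>A\<close> have a good sign, and it can be dropped:
  \<open>\<mu>\<^sub>1 \<integral> \<psi>(U) |DU|\<^sup>2 \<le> \<integral> (\<Lambda>\<^sub>2 |c| U + h\<^sup>-) \<psi>(U)\<close>.  Here \<open>\<mu>\<^sub>1 \<ge> \<nu>\<^sub>1\<close> because \<open>\<theta> \<le> 1\<close>.  If \<open>U \<le> m\<close>, the right
  hand side is at most \<open>(1 + m) F |{U > k}|\<^sup>1\<^sup>-\<^sup>1\<^sup>/\<^sup>p\<close>.  Combined with the Faber-Krahn inequality
  \<open>\<parallel>w\<parallel>\<^sub>2\<^sup>2 \<le> C |supp w|\<^sup>2\<^sup>/\<^sup>n \<parallel>Dw\<parallel>\<^sub>2\<^sup>2\<close> for a smoothed \<open>w = (U - k)\<^sup>+\<close>, this gives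
  \<open>(h - k)\<^sup>2 |{U > h}| \<le> E (1 + m) |{U > k}|\<^sup>1\<^sup>+\<^sup>\<gamma>\<close> with \<open>\<gamma> = 2/n - 1/p > 0\<close>, hence by Stampacchia's iteration
  \<open>m\<^sup>2 \<le> D (1 + m)\<close> up to constants: the gradient term has lowered the power of \<open>U\<close> on the right by one.
\<close>

section \<open>Smooth cut-offs built from exp(-1/t)\<close>

text \<open>The inequality for \<open>u\<close> may only be tested with smooth compactly supported
  functions, while \<open>U\<close> is merely a limit of such functions f_i. Hence the Lipschitz
  truncation \<open>(t - k)^+\<close> and its chain rule are avoided: smooth profiles are applied to
  the f_i, which again gives test functions, and the limit is taken afterwards. Two profiles, both
  zero for t \<le> 0, are coupled: \<psi>(t) = exp(-1/t) for testing the inequality and \<Phi>(t) =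
  t exp(-1/t) as the truncation inserted in the Faber-Krahn inequality. They satisfy (\<Phi>')^2
  \<le> 2 \<psi>, so the energy weighted by \<psi>(U) bounds the full Dirichlet energy of the
  truncation. A power of \<open>t^+\<close> would serve as well in the estimate but is not smooth.
  Both profiles are scaled to the width s = h - k of the gap between two levels. The factor 1/s that
  differentiating \<psi> produces occurs only in the term with \<open>A\<close>, which is discarded
  by its sign, so it costs nothing. The boundedness of \<open>u\<close> supplies a finite
  \<open>m\<close> without any control on its size; the estimate turns this qualitative fact into a
  quantitative one.\<close>

definition flat :: "real poly \<Rightarrow> real \<Rightarrow> real" where
  "flat p t = (if t > 0 then poly p (1 / t) * exp (- (1 / t)) else 0)"

text \<open>With r = 1/t one has d/dt = -r^2 d/dr, so differentiating P(r) exp(-r) gives r^2 (P -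
  P')(r) exp(-r): the family indexed by polynomials is closed under differentiation.\<close>

definition flat_deriv :: "real poly \<Rightarrow> real poly" where
  "flat_deriv p = [:0, 0, 1:] * (p - pderiv p)"

lemma flat_nonpos [simp]: "t \<le> 0 \<Longrightarrow> flat p t = 0"
  by (simp add: flat_def)

lemma poly_times_exp_minus_tendsto_0:
  fixes p :: "real poly"
  shows "((\<lambda>x. poly p x * exp (- x)) \<longlongrightarrow> 0) at_top"
proof -
  have "((\<lambda>x. \<Sum>i\<le>degree p. coeff p i * (x ^ i / exp x)) \<longlongrightarrow> (\<Sum>i\<le>degree p. coeff p i * 0)) at_top"
    by (intro tendsto_sum tendsto_mult tendsto_const tendsto_power_div_exp_0)
  then show ?thesis
    by (simp add: poly_altdef sum_distrib_right exp_minus divide_inverse mult.assoc)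
qed

lemma flat_tendsto_0: "(flat p \<longlongrightarrow> 0) (at_right 0)"
proof -
  have "((\<lambda>t. poly p (inverse t) * exp (- inverse t)) \<longlongrightarrow> 0) (at_right 0)"
    by (rule filterlim_compose[OF poly_times_exp_minus_tendsto_0 filterlim_inverse_at_top_right])
  then show ?thesis
    by (rule tendsto_cong[THEN iffD1, rotated])
       (auto simp: flat_def eventually_at_right_less inverse_eq_divide eventually_at_filter)
qed

lemma DERIV_flat: "(flat p has_real_derivative flat (flat_deriv p) t) (at t)"
proof -
  consider "t > 0" | "t < 0" | "t = 0" by linarith
  then show ?thesis
  proof cases
    case 1
    have "((\<lambda>t. poly p (1 / t) * exp (- (1 / t))) has_real_derivative flat (flat_deriv p) t) (at t)"
      using 1 by (auto intro!: derivative_eq_intros DERIV_chain2[OF poly_DERIV]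
          simp: flat_def flat_deriv_def field_simps)
    then show ?thesis
      by (rule has_field_derivative_transform_within_open[where S = "{0<..}"]) (use 1 in \<open>auto simp: flat_def\<close>)
  next
    case 2
    have "((\<lambda>_. 0) has_real_derivative flat (flat_deriv p) t) (at t)"
      using 2 by simp
    then show ?thesis
      by (rule has_field_derivative_transform_within_open[where S = "{..<0}"]) (use 2 in auto)
  next
    case 3
    have "((\<lambda>h. flat p h / h) \<longlongrightarrow> 0) (at_left 0)"
      by (rule tendsto_eventually) (auto simp: eventually_at_filter)
    \<comment> \<open>Dividing by h multiplies the polynomial in 1/h by its variable, so the
      difference quotient is itself a flat function, with \<open>pCons 0 p\<close> for
      \<open>p\<close>.\<close>
    moreover have "((\<lambda>h. flat p h / h) \<longlongrightarrow> 0) (at_right 0)"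
      by (rule Lim_transform_eventually[OF flat_tendsto_0[of "pCons 0 p"]])
         (auto simp: eventually_at_filter flat_def field_simps)
    ultimately have "((\<lambda>h. flat p h / h) \<longlongrightarrow> 0) (at 0)"
      by (simp add: filterlim_split_at)
    then show ?thesis
      unfolding 3 DERIV_def by simp
  qed
qed

lemma continuous_flat: "continuous_on UNIV (flat p)"
  using DERIV_flat by (meson DERIV_isCont continuous_at_imp_continuous_on)

text \<open>In the variable r = 1/t the function tends to 0 at infinity and is continuous on the
  compact range that remains. The bound is independent of any shift or scaling of the argument and
  provides the dominating constant in the later limit passages.\<close>

lemma bounded_flat: "\<exists>B\<ge>0. \<forall>t. \<bar>flat p t\<bar> \<le> B"
proof -
  have "eventually (\<lambda>x. dist (poly p x * exp (- x)) 0 < 1) at_top"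
    by (rule tendstoD[OF poly_times_exp_minus_tendsto_0]) simp
  then obtain X where X: "\<And>x. x \<ge> X \<Longrightarrow> \<bar>poly p x * exp (- x)\<bar> < 1"
    by (auto simp: eventually_at_top_linorder)
  have "compact ((\<lambda>x. poly p x * exp (- x)) ` {0..X})"
    by (intro compact_continuous_image continuous_intros) auto
  then obtain B where B: "\<And>x. x \<in> {0..X} \<Longrightarrow> \<bar>poly p x * exp (- x)\<bar> \<le> B"
    by (force dest!: compact_imp_bounded simp: bounded_iff)
  have "\<bar>flat p t\<bar> \<le> max B 1" for t
  proof (cases "t > 0")
    case True
    then show ?thesis
      using B[of "1/t"] X[of "1/t"] by (cases "1/t \<le> X") (auto simp: flat_def)
  qed auto
  then show ?thesis by (intro exI[of _ "max B 1"]) auto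
qed

text \<open>The generators below are closed under partial differentiation, so a choice of partial
  derivatives can be iterated along lists of directions.\<close>

inductive smooth_gen :: "(real^'n \<Rightarrow> real) \<Rightarrow> bool" where
  smooth: "smooth_fun f \<Longrightarrow> smooth_gen f"
| const: "smooth_gen (\<lambda>x. c)"
| coord: "smooth_gen (\<lambda>x. x $ i)"
| add: "smooth_gen f \<Longrightarrow> smooth_gen g \<Longrightarrow> smooth_gen (\<lambda>x. f x + g x)"
| mult: "smooth_gen f \<Longrightarrow> smooth_gen g \<Longrightarrow> smooth_gen (\<lambda>x. f x * g x)"
| flat: "smooth_gen f \<Longrightarrow> smooth_gen (\<lambda>x. flat p (f x))"

lemma smooth_gen_partials:
  fixes f :: "real^'n \<Rightarrow> real"
  assumes "smooth_gen f"
  shows "\<exists>d. (\<forall>j. smooth_gen (d j)) \<and> (\<forall>x. (f has_derivative (\<lambda>v. \<Sum>j\<in>UNIV. d j x * v $ j)) (at x))"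
  using assms
proof induction
  case (smooth f)
  then obtain D where D: "D [] = f"
    "\<And>is x. (D is has_derivative (\<lambda>v. \<Sum>j\<in>UNIV. D (j # is) x * v $ j)) (at x)"
    unfolding smooth_fun_def by blast
  \<comment> \<open>New directions are put at the head of the list, so the first derivative taken is
    its last entry: appending \<open>[j]\<close> to every index turns the family of \<open>f\<close>
    into that of its j-th partial derivative.\<close>
  have "smooth_gen (D [j])" for j
    by (rule smooth_gen.smooth) (unfold smooth_fun_def, rule exI[of _ "\<lambda>is. D (is @ [j])"], use D in auto)
  then show ?case
    using D(1) D(2)[of "[]"] by (intro exI[of _ "\<lambda>j. D [j]"]) auto
next
  case (const c)
  show ?case by (intro exI[of _ "\<lambda>_ _. 0"]) (auto intro: smooth_gen.const)
next
  case (coord i)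
  have "(\<Sum>j\<in>UNIV. (if j = i then 1 else 0) * v $ j) = v $ i" for v :: "real^'n"
    by (simp add: if_distrib[of "\<lambda>a. a * _"] cong: if_cong)
  then show ?case
    by (intro exI[of _ "\<lambda>j _. if j = i then 1 else 0"])
       (auto intro: smooth_gen.const bounded_linear_imp_has_derivative bounded_linear_vec_nth)
next
  case (add f g)
  then obtain d e where
    d: "\<And>j. smooth_gen (d j)" "\<And>x. (f has_derivative (\<lambda>v. \<Sum>j\<in>UNIV. d j x * v $ j)) (at x)" and
    e: "\<And>j. smooth_gen (e j)" "\<And>x. (g has_derivative (\<lambda>v. \<Sum>j\<in>UNIV. e j x * v $ j)) (at x)" by blast
  show ?case
    by (intro exI[of _ "\<lambda>j x. d j x + e j x"] conjI allI smooth_gen.add d e)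
       (auto intro!: derivative_eq_intros d(2) e(2) simp: sum.distrib algebra_simps)
next
  case (mult f g)
  then obtain d e where
    d: "\<And>j. smooth_gen (d j)" "\<And>x. (f has_derivative (\<lambda>v. \<Sum>j\<in>UNIV. d j x * v $ j)) (at x)" and
    e: "\<And>j. smooth_gen (e j)" "\<And>x. (g has_derivative (\<lambda>v. \<Sum>j\<in>UNIV. e j x * v $ j)) (at x)" by blast
  show ?case
    by (intro exI[of _ "\<lambda>j x. f x * e j x + d j x * g x"] conjI allI smooth_gen.add smooth_gen.mult
         mult.hyps d e)
       (auto intro!: derivative_eq_intros d(2) e(2) simp: sum.distrib algebra_simps sum_distrib_left)
next
  case (flat f p)
  then obtain d where
    d: "\<And>j. smooth_gen (d j)" "\<And>x. (f has_derivative (\<lambda>v. \<Sum>j\<in>UNIV. d j x * v $ j)) (at x)" by blast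
  have "((\<lambda>x. flat p (f x)) has_derivative (\<lambda>v. flat (flat_deriv p) (f x) * (\<Sum>j\<in>UNIV. d j x * v $ j))) (at x)" for x
    using has_derivative_compose[OF d(2) DERIV_flat[unfolded has_field_derivative_def]] .
  then show ?case
    by (intro exI[of _ "\<lambda>j x. flat (flat_deriv p) (f x) * d j x"])
       (auto intro!: smooth_gen.mult smooth_gen.flat flat.hyps d simp: sum_distrib_left mult.assoc)
qed

lemma smooth_gen_imp_smooth_fun:
  fixes f :: "real^'n \<Rightarrow> real"
  assumes "smooth_gen f"
  shows "smooth_fun f"
proof -
  obtain d where d: "\<And>f :: real^'n \<Rightarrow> real. smooth_gen f \<Longrightarrow>
      (\<forall>j. smooth_gen (d f j)) \<and> (\<forall>x. (f has_derivative (\<lambda>v. \<Sum>j\<in>UNIV. d f j x * v $ j)) (at x))"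
    using smooth_gen_partials by metis
  define D where "D = rec_list f (\<lambda>j _ r. d r j)"
  have D: "D [] = f" "D (j # is) = d (D is) j" for j "is"
    by (simp_all add: D_def)
  have "smooth_gen (D is)" for "is"
    by (induction "is") (use D d assms in auto)
  then show ?thesis
    unfolding smooth_fun_def using D d by (intro exI[of _ D]) auto
qed

lemma smooth_fun_const: "smooth_fun (\<lambda>x. c)"
  and smooth_fun_coord: "smooth_fun (\<lambda>x. x $ i)"
  and smooth_fun_add: "smooth_fun f \<Longrightarrow> smooth_fun g \<Longrightarrow> smooth_fun (\<lambda>x. f x + g x)"
  and smooth_fun_mult: "smooth_fun f \<Longrightarrow> smooth_fun g \<Longrightarrow> smooth_fun (\<lambda>x. f x * g x)"
  and smooth_fun_flat: "smooth_fun f \<Longrightarrow> smooth_fun (\<lambda>x. flat p (f x))"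
  by (auto intro: smooth_gen_imp_smooth_fun smooth_gen.intros)

lemma smooth_fun_affine: "smooth_fun f \<Longrightarrow> smooth_fun (\<lambda>x. a * f x + b)"
  by (intro smooth_fun_add smooth_fun_mult smooth_fun_const)

lemma smooth_fun_flat_affine:
  assumes "smooth_fun f" shows "smooth_fun (\<lambda>x. flat p ((f x - k) / s))"
proof -
  have "(\<lambda>x. flat p ((f x - k) / s)) = (\<lambda>x. flat p (1 / s * f x + - k / s))"
    by (simp add: diff_divide_distrib)
  then show ?thesis
    by (simp only: smooth_fun_flat smooth_fun_affine assms)
qed

lemma smooth_fun_prod:
  assumes "finite I" "\<And>i. i \<in> I \<Longrightarrow> smooth_fun (f i)"
  shows "smooth_fun (\<lambda>x. \<Prod>i\<in>I. f i x)"
  using assms by (induction I rule: finite_induct) (auto intro: smooth_fun_const smooth_fun_mult)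

lemma test_funI_support:
  assumes "smooth_fun f" "compact K" "K \<subseteq> \<Omega>" "\<And>x. f x \<noteq> 0 \<Longrightarrow> x \<in> K"
  shows "test_fun \<Omega> f"
proof -
  have "closure {x. f x \<noteq> 0} \<subseteq> K"
    using assms by (intro closure_minimal compact_imp_closed) auto
  then show ?thesis
    unfolding test_fun_def using assms compact_closure bounded_subset[OF compact_imp_bounded[OF assms(2)]]
    by (metis bounded_closure_image closure_subset compact_eq_bounded_closed closed_closure subset_trans bounded_subset)
qed

lemma test_fun_mult_right:
  assumes "test_fun \<Omega> f" "smooth_fun g"
  shows "test_fun \<Omega> (\<lambda>x. f x * g x)"
  using assms closure_subset[of "{x. f x \<noteq> 0}"]
  by (intro test_funI_support[where K = "closure {x. f x \<noteq> 0}"])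
     (auto simp: test_fun_def intro: smooth_fun_mult)

text \<open>The condition k \<ge> 0 keeps the support inside that of \<open>f\<close>: where
  \<open>f\<close> vanishes the argument is nonpositive and the profile is zero.\<close>

lemma test_fun_flat:
  assumes "test_fun \<Omega> f" "k \<ge> 0" "s > 0"
  shows "test_fun \<Omega> (\<lambda>x. flat p ((f x - k) / s))"
proof (rule test_funI_support[where K = "closure {x. f x \<noteq> 0}"])
  fix x assume "flat p ((f x - k) / s) \<noteq> 0"
  then have "(f x - k) / s > 0" by (meson flat_nonpos not_le)
  then have "f x \<noteq> 0" using assms by (auto simp: zero_less_divide_iff)
  then show "x \<in> closure {x. f x \<noteq> 0}" using closure_subset[of "{x. f x \<noteq> 0}"] by auto
qed (use assms in \<open>auto simp: test_fun_def intro: smooth_fun_flat_affine\<close>)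

section \<open>Gradients of test functions: continuity, support and bounds\<close>

lemma smooth_fun_gradient:
  fixes f :: "real^'n \<Rightarrow> real"
  assumes "smooth_fun f"
  obtains g where "\<And>x. (f has_derivative (\<lambda>v. g x \<bullet> v)) (at x)" "continuous_on UNIV g"
proof -
  obtain D where D: "D [] = f"
    "\<And>is x. (D is has_derivative (\<lambda>v. \<Sum>j\<in>UNIV. D (j # is) x * v $ j)) (at x)"
    using assms unfolding smooth_fun_def by blast
  define g where "g x = (\<chi> j. D [j] x)" for x
  have "continuous_on UNIV (D [j])" for j
    using D(2)[of "[j]"] by (meson continuous_at_imp_continuous_on has_derivative_continuous)
  then have "continuous_on UNIV g"
    unfolding g_def by (intro continuous_on_vec_lambda)
  moreover have "(f has_derivative (\<lambda>v. g x \<bullet> v)) (at x)" for x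
    using D(2)[of "[]" x] by (simp add: D(1) g_def inner_vec_def)
  ultimately show ?thesis using that by blast
qed

lemma inner_gradient_unique:
  assumes "(f has_derivative (\<lambda>v. a \<bullet> v)) (at x)" "(f has_derivative (\<lambda>v. b \<bullet> v)) (at x)"
  shows "a = b"
proof -
  have "(\<lambda>v. a \<bullet> v) = (\<lambda>v. b \<bullet> v)" by (rule has_derivative_unique[OF assms])
  then have "a \<bullet> (a - b) = b \<bullet> (a - b)" by metis
  then have "(a - b) \<bullet> (a - b) = 0" by (simp add: inner_diff_left)
  then show ?thesis by simp
qed

text \<open>The definitions of \<open>H10\<close> and \<open>supersolution\<close> speak of an
  arbitrary function representing the derivative. Uniqueness of gradients identifies it with the
  continuous one built from the partial derivatives, so it is measurable and bounded.\<close>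

lemma test_fun_gradient_continuous:
  fixes f :: "real^'n \<Rightarrow> real"
  assumes "test_fun \<Omega> f" "\<And>x. (f has_derivative (\<lambda>v. g x \<bullet> v)) (at x)"
  shows "continuous_on UNIV g"
proof -
  obtain g' where "\<And>x. (f has_derivative (\<lambda>v. g' x \<bullet> v)) (at x)" "continuous_on UNIV g'"
    using smooth_fun_gradient assms unfolding test_fun_def by metis
  moreover from this have "g' = g"
    using assms(2) inner_gradient_unique by blast
  ultimately show ?thesis by simp
qed

lemma test_fun_continuous:
  assumes "test_fun \<Omega> f" shows "continuous_on UNIV f"
  using assms unfolding test_fun_def
  by (meson smooth_fun_gradient continuous_at_imp_continuous_on has_derivative_continuous)

lemma test_fun_eq_0: "test_fun \<Omega> f \<Longrightarrow> x \<notin> \<Omega> \<Longrightarrow> f x = 0"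
  using closure_subset[of "{x. f x \<noteq> 0}"] unfolding test_fun_def by auto

lemma gradient_eq_0_outside_support:
  fixes f :: "real^'n \<Rightarrow> real"
  assumes "(f has_derivative (\<lambda>v. g \<bullet> v)) (at x)" "x \<notin> closure {x. f x \<noteq> 0}"
  shows "g = 0"
proof -
  have "((\<lambda>_. 0) has_derivative (\<lambda>v. g \<bullet> v)) (at x)"
    by (rule has_derivative_transform_within_open[OF assms(1), of "- closure {x. f x \<noteq> 0}"])
       (use assms(2) closure_subset[of "{x. f x \<noteq> 0}"] in auto)
  then show ?thesis
    using inner_gradient_unique[of "\<lambda>_. 0" g x 0] by simp
qed

lemma continuous_compact_support_bounded:
  fixes f :: "'a::metric_space \<Rightarrow> 'b::real_normed_vector"
  assumes "continuous_on UNIV f" "compact K" "\<And>x. x \<notin> K \<Longrightarrow> f x = 0"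
  obtains B where "\<And>x. norm (f x) \<le> B" "B \<ge> 0"
proof -
  have "compact (f ` K)"
    using assms by (intro compact_continuous_image) (auto intro: continuous_on_subset)
  then obtain B where "\<And>x. x \<in> K \<Longrightarrow> norm (f x) \<le> B"
    by (force dest!: compact_imp_bounded simp: bounded_iff)
  then have "norm (f x) \<le> max B 0" for x
    using assms(3)[of x] by (cases "x \<in> K") fastforce+
  then show ?thesis using that[of "max B 0"] by auto
qed

lemma test_fun_bounded:
  assumes "test_fun \<Omega> f"
  obtains B where "\<And>x. \<bar>f x\<bar> \<le> B" "B \<ge> 0"
proof (rule continuous_compact_support_bounded[OF test_fun_continuous[OF assms]])
  show "compact (closure {x. f x \<noteq> 0})" using assms by (simp add: test_fun_def)
  show "x \<notin> closure {x. f x \<noteq> 0} \<Longrightarrow> f x = 0" for x using closure_subset[of "{x. f x \<noteq> 0}"] by auto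
qed (use that in auto)

lemma test_fun_gradient_bounded:
  assumes "test_fun \<Omega> f" "\<And>x. (f has_derivative (\<lambda>v. g x \<bullet> v)) (at x)"
  obtains B where "\<And>x. norm (g x) \<le> B" "B \<ge> 0"
proof (rule continuous_compact_support_bounded[OF test_fun_gradient_continuous[OF assms]])
  show "compact (closure {x. f x \<noteq> 0})" using assms by (simp add: test_fun_def)
  show "x \<notin> closure {x. f x \<noteq> 0} \<Longrightarrow> g x = 0" for x
    using gradient_eq_0_outside_support assms(2) by blast
qed (use that in auto)

lemma has_derivative_flat_affine:
  assumes "(f has_derivative (\<lambda>v. g \<bullet> v)) (at x)"
  shows "((\<lambda>x. flat p ((f x - k) / s)) has_derivative
          (\<lambda>v. ((flat (flat_deriv p) ((f x - k) / s) / s) *\<^sub>R g) \<bullet> v)) (at x)"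
proof -
  have 1: "((\<lambda>x. (f x - k) / s) has_derivative (\<lambda>v. (g \<bullet> v) / s)) (at x)"
    by (auto intro!: derivative_eq_intros assms simp: divide_inverse)
  show ?thesis
    using has_derivative_compose[OF 1 DERIV_flat[unfolded has_field_derivative_def]] by simp
qed

section \<open>Smooth approximations of indicators of boxes\<close>

definition box_bump :: "real^'n \<Rightarrow> real^'n \<Rightarrow> nat \<Rightarrow> real^'n \<Rightarrow> real" where
  "box_bump a b N x = (\<Prod>i\<in>UNIV. flat 1 (Suc N * (x $ i - a $ i)) * flat 1 (Suc N * (b $ i - x $ i)))"

lemma flat_1_bounds: "0 \<le> flat 1 t" "flat 1 t \<le> 1" "t > 0 \<Longrightarrow> flat 1 t > 0"
  by (auto simp: flat_def)

lemma flat_1_tendsto: "(\<lambda>N. flat 1 (real (Suc N) * t)) \<longlonglongrightarrow> (if t > 0 then 1 else 0)"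
proof (cases "t > 0")
  case True
  have "(\<lambda>N. exp (- (inverse (real (Suc N)) * (1 / t)))) \<longlonglongrightarrow> exp (- (0 * (1 / t)))"
    by (intro tendsto_intros LIMSEQ_inverse_real_of_nat)
  then have "(\<lambda>N. exp (- (1 / (real (Suc N) * t)))) \<longlonglongrightarrow> 1"
    by (simp add: divide_inverse mult.assoc del: of_nat_Suc)
  moreover have "real (Suc N) * t > 0" for N using True by simp
  ultimately show ?thesis using True by (simp add: flat_def del: of_nat_Suc)
next
  case False
  then have "real (Suc N) * t \<le> 0" for N by (simp add: mult_nonneg_nonpos)
  then show ?thesis using False by (simp del: of_nat_Suc)
qed

text \<open>Stretching the argument makes exp(-1/((N+1) t)) tend to 1 for each t > 0, while it stays
  0 for t \<le> 0; faces of the box are therefore excluded in the limit. This is how integrals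
  against test functions turn into integrals over boxes.\<close>

lemma box_bump_tendsto: "(\<lambda>N. box_bump a b N x) \<longlonglongrightarrow> indicator (box a b) x"
proof -
  have "indicator (box a b) x =
      (\<Prod>i\<in>UNIV. (if x $ i - a $ i > 0 then 1 else 0) * (if b $ i - x $ i > 0 then 1 else (0::real)))"
    by (auto simp: indicator_def mem_box_cart intro!: prod.neutral)
  then show ?thesis
    unfolding box_bump_def by (simp only:) (intro tendsto_prod tendsto_mult flat_1_tendsto)
qed

lemma box_bump_bounds: "0 \<le> box_bump a b N x" "box_bump a b N x \<le> 1"
  unfolding box_bump_def
  by (auto intro!: prod_nonneg prod_le_1 mult_nonneg_nonneg mult_le_one flat_1_bounds)

lemma box_bump_eq_0: assumes "x \<notin> box a b" shows "box_bump a b N x = 0"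
proof -
  obtain i where "x $ i \<le> a $ i \<or> b $ i \<le> x $ i" using assms by (auto simp: mem_box_cart not_less)
  then have "real (Suc N) * (x $ i - a $ i) \<le> 0 \<or> real (Suc N) * (b $ i - x $ i) \<le> 0"
    by (auto intro: mult_nonneg_nonpos)
  then have "flat 1 (Suc N * (x $ i - a $ i)) * flat 1 (Suc N * (b $ i - x $ i)) = 0"
    by (auto simp del: of_nat_Suc)
  then show ?thesis unfolding box_bump_def by (intro prod_zero) auto
qed

lemma smooth_fun_box_bump: "smooth_fun (box_bump a b N)"
proof -
  have "smooth_fun (\<lambda>x. flat 1 (real (Suc N) * x $ i + - (Suc N * a $ i)) * flat 1 (- real (Suc N) * x $ i + (Suc N * b $ i)))" for i
    by (intro smooth_fun_mult smooth_fun_flat smooth_fun_affine smooth_fun_coord)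
  then have *: "smooth_fun (\<lambda>x. flat 1 (Suc N * (x $ i - a $ i)) * flat 1 (Suc N * (b $ i - x $ i)))" for i
    by (simp add: algebra_simps del: of_nat_Suc)
  show ?thesis
    unfolding box_bump_def[abs_def] by (intro smooth_fun_prod *) auto
qed

lemma test_fun_box_bump: "cbox a b \<subseteq> \<Omega> \<Longrightarrow> test_fun \<Omega> (box_bump a b N)"
  by (rule test_funI_support[OF smooth_fun_box_bump compact_cbox])
     (use box_bump_eq_0 box_subset_cbox in \<open>fastforce+\<close>)

section \<open>Fundamental lemma and Faber-Krahn inequality\<close>

lemma integrable_lebesgue_on_iff:
  fixes f :: "'a::euclidean_space \<Rightarrow> real"
  assumes "\<Omega> \<in> sets lebesgue"
  shows "integrable (lebesgue_on \<Omega>) f \<longleftrightarrow> integrable lebesgue (\<lambda>x. indicator \<Omega> x * f x)"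
  using integrable_restrict_space[of \<Omega> lebesgue f] assms by simp

lemma integral_lebesgue_on_eq:
  fixes f :: "'a::euclidean_space \<Rightarrow> real"
  assumes "\<Omega> \<in> sets lebesgue"
  shows "(\<integral>x. f x \<partial>lebesgue_on \<Omega>) = (\<integral>x. indicator \<Omega> x * f x \<partial>lebesgue)"
  using integral_restrict_space[of \<Omega> lebesgue f] assms by simp

text \<open>Open boxes form an intersection-stable generator of the Borel sets, so by Dynkin's
  argument the integral vanishes over every Borel set, which forces the density to vanish.\<close>

lemma AE_lborel_zero_of_integral_box_zero:
  fixes f :: "'a::euclidean_space \<Rightarrow> real"
  assumes f: "integrable lborel f"
    and box: "\<And>a b. (\<integral>x. indicator (box a b) x * f x \<partial>lborel) = 0"
  shows "AE x in lborel. f x = 0"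
proof (rule sigma_finite_measure.density_zero[OF sigma_finite_lborel f])
  \<comment> \<open>The complement step of the Dynkin argument needs the integral over the whole
    space. As this is not a box, it is obtained from an exhaustion by growing boxes.\<close>
  have total: "(\<integral>x. f x \<partial>lborel) = 0"
  proof -
    let ?A = "\<lambda>n::nat. box (- (real n *\<^sub>R One)) (real n *\<^sub>R One) :: 'a set"
    have "(\<lambda>n. \<integral>x. indicator (?A n) x * f x \<partial>lborel) \<longlonglongrightarrow> (\<integral>x. f x \<partial>lborel)"
    proof (rule integral_dominated_convergence[where w = "\<lambda>x. norm (f x)"])
      show "AE x in lborel. (\<lambda>n. indicator (?A n) x * f x) \<longlonglongrightarrow> f x"
      proof (rule AE_I2)
        fix x :: 'a
        obtain m where m: "x \<in> ?A m" using UN_box_eq_UNIV by blast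
        have "?A m \<subseteq> ?A n" if "n \<ge> m" for n
          using that by (intro subset_box_imp) (auto simp: inner_simps)
        then have "eventually (\<lambda>n. indicator (?A n) x * f x = f x) sequentially"
          using m by (force simp: eventually_sequentially indicator_def)
        then show "(\<lambda>n. indicator (?A n) x * f x) \<longlonglongrightarrow> f x" by (rule tendsto_eventually)
      qed
    qed (use f in \<open>auto split: split_indicator\<close>)
    then show ?thesis using box by (simp add: LIMSEQ_const_iff)
  qed
  fix A :: "'a set" assume "A \<in> sets lborel"
  have Int_stable: "Int_stable (range (\<lambda>(a, b). box a b :: 'a set))"
    by (auto simp: Int_stable_def box_Int_box)
  have sub: "range (\<lambda>(a, b). box a b :: 'a set) \<subseteq> Pow UNIV" by simp
  from \<open>A \<in> sets lborel\<close> have "A \<in> sigma_sets UNIV (range (\<lambda>(a, b). box a b))"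
    by (simp add: borel_eq_box)
  then show "set_lebesgue_integral lborel A f = 0"
  proof (induction rule: sigma_sets_induct_disjoint[OF Int_stable sub, consumes 1,
      case_names basic empty compl union])
    case (basic A)
    then show ?case using box by (auto simp: set_lebesgue_integral_def)
  next
    case (compl A)
    then have A: "A \<in> sets lborel" by (simp add: borel_eq_box)
    have "set_lebesgue_integral lborel (UNIV - A) f = (\<integral>x. f x - indicator A x *\<^sub>R f x \<partial>lborel)"
      unfolding set_lebesgue_integral_def
      by (intro Bochner_Integration.integral_cong) (auto split: split_indicator)
    also have "\<dots> = 0"
      using compl total
      by (subst Bochner_Integration.integral_diff[OF f integrable_mult_indicator[OF A f]])
         (simp add: set_lebesgue_integral_def)
    finally show ?case .
  next
    case (union A)
    then have A: "\<And>i. A i \<in> sets lborel" by (auto simp: borel_eq_box)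
    have "set_lebesgue_integral lborel (\<Union>i. A i) f = (\<Sum>i. set_lebesgue_integral lborel (A i) f)"
    proof (rule lebesgue_integral_countable_add)
      show "set_integrable lborel (\<Union> (range A)) f"
        unfolding set_integrable_def by (rule integrable_mult_indicator) (use A f in auto)
    qed (use A union in \<open>auto simp: disjoint_family_on_def\<close>)
    then show ?case using union by simp
  qed (simp add: set_lebesgue_integral_def)
qed

text \<open>Reduction to the Borel case: a Lebesgue measurable function agrees almost everywhere
  with a Borel measurable one.\<close>

lemma AE_lebesgue_zero_of_integral_box_zero:
  fixes f :: "'a::euclidean_space \<Rightarrow> real"
  assumes f: "integrable lebesgue f"
    and box: "\<And>a b. (\<integral>x. indicator (box a b) x * f x \<partial>lebesgue) = 0"
  shows "AE x in lebesgue. f x = 0"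
proof -
  obtain f' where f'[measurable]: "f' \<in> borel_measurable lborel" and eq: "AE x in lborel. f x = f' x"
    using completion_ex_borel_measurable_real[OF borel_measurable_integrable[OF f]] by auto
  have eq': "AE x in lebesgue. f x = f' x" using eq by (rule AE_completion)
  have f'_leb: "f' \<in> borel_measurable lebesgue" using f' by (rule measurable_completion)
  have "integrable lebesgue f'"
    by (rule integrable_cong_AE_imp[OF f f'_leb eq'])
  then have int: "integrable lborel f'" by (simp add: integrable_completion)
  have "(\<integral>x. indicator (box a b) x * f' x \<partial>lborel) = 0" for a b
  proof -
    have "(\<integral>x. indicator (box a b) x * f' x \<partial>lborel) = (\<integral>x. indicator (box a b) x * f' x \<partial>lebesgue)"
      by (subst integral_completion) auto
    also have "\<dots> = (\<integral>x. indicator (box a b) x * f x \<partial>lebesgue)"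
      using eq' by (intro integral_cong_AE borel_measurable_times f'_leb borel_measurable_integrable[OF f]
          borel_measurable_indicator) auto
    finally show ?thesis using box by simp
  qed
  then have "AE x in lborel. f' x = 0"
    by (rule AE_lborel_zero_of_integral_box_zero[OF int])
  then have "AE x in lebesgue. f' x = 0" by (rule AE_completion)
  then show ?thesis using eq' by eventually_elim simp
qed

text \<open>The fundamental lemma of the calculus of variations. It is proved on each box whose
  closure lies in \<Omega>; countably many closed boxes cover \<Omega>, and their faces are
  negligible.\<close>

lemma AE_zero_of_integral_test_fun_zero:
  fixes f :: "real^'n \<Rightarrow> real"
  assumes "open \<Omega>" and f: "integrable (lebesgue_on \<Omega>) f"
    and test: "\<And>\<eta>. test_fun \<Omega> \<eta> \<Longrightarrow> (\<integral>x. f x * \<eta> x \<partial>lebesgue_on \<Omega>) = 0"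
  shows "AE x in lebesgue_on \<Omega>. f x = 0"
proof -
  have \<Omega>: "\<Omega> \<in> sets lebesgue" using \<open>open \<Omega>\<close> by (simp add: borel_open)
  have fm: "f \<in> borel_measurable (lebesgue_on \<Omega>)" using f by simp
  have bm: "box_bump a b N \<in> borel_measurable (lebesgue_on \<Omega>)" for a b N
    by (rule continuous_imp_measurable_on_sets_lebesgue[OF _ \<Omega>])
       (meson UNIV_I continuous_on_subset subset_UNIV smooth_fun_gradient[OF smooth_fun_box_bump]
         has_derivative_continuous continuous_at_imp_continuous_on)
  have box: "AE x in lebesgue. x \<in> box a b \<longrightarrow> f x = 0" if ab: "cbox a b \<subseteq> \<Omega>" for a b
  proof -
    have sub: "box a b \<subseteq> \<Omega>" using ab box_subset_cbox by blast
    have int: "integrable lebesgue (\<lambda>x. indicator (box a b) x * f x)"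
    proof -
      have "integrable lebesgue (\<lambda>x. indicator (box a b) x *\<^sub>R (indicator \<Omega> x * f x))"
        using f unfolding integrable_lebesgue_on_iff[OF \<Omega>] by (rule integrable_mult_indicator[rotated]) auto
      then show ?thesis
        by (rule Bochner_Integration.integrable_cong[THEN iffD1, rotated -1])
           (use sub in \<open>auto split: split_indicator\<close>)
    qed
    \<comment> \<open>A product of two bumps is used: the one for \<open>box a b\<close> confines
      the support to \<Omega>, so that \<open>box c d\<close> may be arbitrary, as the criterion for
      functions on the whole space demands.\<close>
    have "(\<integral>x. indicator (box c d) x * (indicator (box a b) x * f x) \<partial>lebesgue) = 0" for c d
    proof -
      have "(\<lambda>N. \<integral>x. f x * (box_bump a b N x * box_bump c d N x) \<partial>lebesgue_on \<Omega>)
              \<longlonglongrightarrow> (\<integral>x. f x * (indicator (box a b) x * indicator (box c d) x) \<partial>lebesgue_on \<Omega>)"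
      proof (rule integral_dominated_convergence[where w = "\<lambda>x. norm (f x)"])
        show "AE x in lebesgue_on \<Omega>. norm (f x * (box_bump a b N x * box_bump c d N x)) \<le> norm (f x)" for N
          by (auto simp: abs_mult box_bump_bounds intro!: mult_left_le mult_le_one)
        show "(\<lambda>x. f x * (indicator (box a b) x * indicator (box c d) x)) \<in> borel_measurable (lebesgue_on \<Omega>)"
          by (intro borel_measurable_times fm measurable_restrict_space1 borel_measurable_indicator) auto
      qed (use f fm in \<open>auto intro!: tendsto_intros box_bump_tendsto borel_measurable_times bm\<close>)
      moreover have "(\<integral>x. f x * (box_bump a b N x * box_bump c d N x) \<partial>lebesgue_on \<Omega>) = 0" for N
        by (intro test test_fun_mult_right test_fun_box_bump ab smooth_fun_box_bump)
      ultimately have "(\<integral>x. f x * (indicator (box a b) x * indicator (box c d) x) \<partial>lebesgue_on \<Omega>) = 0"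
        by (simp add: LIMSEQ_const_iff)
      moreover have "indicator \<Omega> x * (f x * (indicator (box a b) x * indicator (box c d) x)) =
          indicator (box c d) x * (indicator (box a b) x * f x)" for x
        using sub by (auto split: split_indicator)
      ultimately show ?thesis
        by (simp add: integral_lebesgue_on_eq[OF \<Omega>])
    qed
    from AE_lebesgue_zero_of_integral_box_zero[OF int this]
    show ?thesis by eventually_elim (auto split: split_indicator_asm)
  qed
  obtain \<D> where \<D>: "countable \<D>" "\<D> \<subseteq> Pow \<Omega>" "\<And>X. X \<in> \<D> \<Longrightarrow> \<exists>a b. X = cbox a b" "\<Union>\<D> = \<Omega>"
    using open_countable_Union_open_cbox[OF \<open>open \<Omega>\<close>] by metis
  have "AE x in lebesgue. x \<in> X \<longrightarrow> f x = 0" if X_in: "X \<in> \<D>" for X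
  proof -
    obtain a b where X: "X = cbox a b" using \<D>(3)[OF X_in] by blast
    have "negligible (cbox a b - box a b)" by (rule negligible_frontier_interval)
    then have "AE x in lebesgue. x \<notin> cbox a b - box a b"
      by (intro AE_not_in) (simp add: negligible_iff_null_sets)
    moreover have "AE x in lebesgue. x \<in> box a b \<longrightarrow> f x = 0" using X \<D>(2) X_in by (intro box) auto
    ultimately show ?thesis by eventually_elim (use X in auto)
  qed
  then have "AE x in lebesgue. \<forall>X\<in>\<D>. x \<in> X \<longrightarrow> f x = 0"
    unfolding AE_ball_countable[OF \<D>(1)] by blast
  then show ?thesis
    unfolding AE_restrict_space_iff[of \<Omega> lebesgue, simplified, OF \<Omega>]
    by eventually_elim (use \<D>(4) in auto)
qed

text \<open>Indices are chosen so sparse that the i-th integral is below 2^(-i). The sum of the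
  selected functions is then integrable; it majorises each of them, and its finiteness almost
  everywhere forces the terms to tend to 0.\<close>

lemma L1_null_sequence_dominated_subseq:
  fixes d :: "nat \<Rightarrow> 'a \<Rightarrow> real"
  assumes int: "\<And>i. integrable M (d i)" and nonneg: "\<And>i x. 0 \<le> d i x"
    and lim: "(\<lambda>i. \<integral>x. d i x \<partial>M) \<longlonglongrightarrow> 0"
  obtains r S where "strict_mono r" "integrable M S"
    "AE x in M. (\<forall>i. d (r i) x \<le> S x) \<and> (\<lambda>i. d (r i) x) \<longlonglongrightarrow> 0"
proof -
  have "\<exists>r::nat \<Rightarrow> nat. \<forall>i. (\<integral>x. d (r i) x \<partial>M) < (1/2)^i \<and> r i < r (Suc i)"
  proof (rule dependent_nat_choice)
    have ex: "\<exists>y>k. (\<integral>x. d y x \<partial>M) < e" if "e > 0" for e :: real and k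
    proof -
      have "eventually (\<lambda>n. (\<integral>x. d n x \<partial>M) < e \<and> n > k) sequentially"
        using order_tendstoD(2)[OF lim that] eventually_gt_at_top[of k] by (rule eventually_conj)
      from eventually_happens'[OF sequentially_bot this] show ?thesis by blast
    qed
    show "\<exists>x. (\<integral>y. d x y \<partial>M) < (1/2)^0" using ex[of 1 0] by auto
    show "\<exists>y. (\<integral>z. d y z \<partial>M) < (1/2)^Suc n \<and> x < y" for x n
      using ex[of "(1/2)^Suc n" x] by auto
  qed
  then obtain r where r: "strict_mono r" "\<And>i. (\<integral>x. d (r i) x \<partial>M) < (1/2)^i"
    by (auto simp: strict_mono_Suc_iff)
  have [measurable]: "d i \<in> borel_measurable M" for i using int by simp
  define T where "T x = (\<Sum>i. ennreal (d (r i) x))" for x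
  have [measurable]: "T \<in> borel_measurable M" unfolding T_def by measurable
  have "(\<integral>\<^sup>+x. T x \<partial>M) = (\<Sum>i. \<integral>\<^sup>+x. ennreal (d (r i) x) \<partial>M)"
    unfolding T_def by (intro nn_integral_suminf) simp
  also have "\<dots> = (\<Sum>i. ennreal (\<integral>x. d (r i) x \<partial>M))"
    by (intro arg_cong[where f = suminf] ext nn_integral_eq_integral int AE_I2 nonneg)
  also have "\<dots> \<le> (\<Sum>i. ennreal ((1/2)^i))"
    by (intro suminf_le ennreal_leI less_imp_le r) auto
  also have "\<dots> = ennreal (\<Sum>i. (1/2)^i)"
    by (intro suminf_ennreal2 summable_geometric) auto
  also have "\<dots> < \<infinity>" by simp
  finally have fin: "(\<integral>\<^sup>+x. T x \<partial>M) < \<infinity>" .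
  then have AE: "AE x in M. T x \<noteq> \<infinity>" by (intro nn_integral_noteq_infinite) auto
  show ?thesis
  proof (rule that[OF r(1)])
    show "integrable M (\<lambda>x. enn2real (T x))"
    proof (rule integrableI_bounded)
      have "(\<integral>\<^sup>+x. ennreal (norm (enn2real (T x))) \<partial>M) \<le> (\<integral>\<^sup>+x. T x \<partial>M)"
        by (intro nn_integral_mono) (simp add: ennreal_enn2real_if)
      then show "(\<integral>\<^sup>+x. ennreal (norm (enn2real (T x))) \<partial>M) < \<infinity>" using fin by (rule le_less_trans)
    qed simp
    show "AE x in M. (\<forall>i. d (r i) x \<le> enn2real (T x)) \<and> (\<lambda>i. d (r i) x) \<longlonglongrightarrow> 0"
      using AE
    proof eventually_elim
      case (elim x)
      have "summable (\<lambda>i. d (r i) x)"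
        using elim unfolding T_def by (intro summable_suminf_not_top nonneg) simp
      then have "(\<lambda>i. d (r i) x) \<longlonglongrightarrow> 0" by (rule summable_LIMSEQ_zero)
      moreover have "d (r i) x \<le> enn2real (T x)" for i
      proof -
        have "ennreal (d (r i) x) = (\<Sum>j\<in>{i}. ennreal (d (r j) x))" by simp
        also have "\<dots> \<le> T x" unfolding T_def by (rule sum_le_suminf) auto
        finally show ?thesis using elim nonneg enn2real_mono[of "ennreal (d (r i) x)" "T x"]
          by (simp add: top.not_eq_extremum)
      qed
      ultimately show ?case by simp
    qed
  qed
qed

section \<open>Translation estimates for the Faber-Krahn inequality\<close>

lemma nn_integral_lborel_translate:
  fixes f :: "'a::euclidean_space \<Rightarrow> ennreal"
  assumes [measurable]: "f \<in> borel_measurable borel"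
  shows "(\<integral>\<^sup>+x. f (x + z) \<partial>lborel) = (\<integral>\<^sup>+x. f x \<partial>lborel)"
proof -
  have "(\<integral>\<^sup>+x. f x \<partial>lborel) = (\<integral>\<^sup>+x. f x \<partial>distr lborel borel ((+) z))"
    by (simp add: lborel_distr_plus)
  also have "\<dots> = (\<integral>\<^sup>+x. f (z + x) \<partial>lborel)"
    by (intro nn_integral_distr) auto
  finally show ?thesis by (simp add: add.commute)
qed

text \<open>The increment is the integral of the directional derivative along the segment from x to
  x + z; Cauchy-Schwarz on the unit interval squares it. Working in \<open>ennreal\<close> makes
  Tonelli applicable afterwards without integrability conditions.\<close>

lemma square_increment_le_nn_integral:
  fixes f :: "real^'n \<Rightarrow> real"
  assumes f: "\<And>x. (f has_derivative (\<lambda>v. g x \<bullet> v)) (at x)" and g: "continuous_on UNIV g"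
  shows "ennreal ((f (x + z) - f x)\<^sup>2) \<le>
    ennreal ((norm z)\<^sup>2) * (\<integral>\<^sup>+t. indicator {0..1} t * ennreal ((norm (g (x + t *\<^sub>R z)))\<^sup>2) \<partial>lborel)"
proof -
  define h where "h t = g (x + t *\<^sub>R z) \<bullet> z" for t
  have ch: "continuous_on UNIV h"
    unfolding h_def by (intro continuous_intros continuous_on_compose2[OF g]) auto
  then have [measurable]: "h \<in> borel_measurable borel" by (rule borel_measurable_continuous_onI)
  have gm [measurable]: "g \<in> borel_measurable borel" using g by (rule borel_measurable_continuous_onI)
  have deriv: "((\<lambda>t. f (x + t *\<^sub>R z)) has_vector_derivative h t) (at t within {0..1})" for t
  proof -
    have "((\<lambda>t. x + t *\<^sub>R z) has_derivative (\<lambda>s. s *\<^sub>R z)) (at t within {0..1})"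
      by (auto intro!: derivative_eq_intros)
    from has_derivative_compose[OF this f]
    show ?thesis by (simp add: has_vector_derivative_def h_def)
  qed
  have "(\<integral>t. indicator {0..1} t *\<^sub>R h t \<partial>lborel) = f (x + 1 *\<^sub>R z) - f (x + 0 *\<^sub>R z)"
    using deriv ch by (intro integral_FTC_Icc) (auto intro: continuous_on_subset)
  then have "ennreal \<bar>f (x + z) - f x\<bar> = ennreal (norm (\<integral>t. indicator {0..1} t *\<^sub>R h t \<partial>lborel))" by simp
  also have "\<dots> \<le> (\<integral>\<^sup>+t. norm (indicator {0..1} t *\<^sub>R h t) \<partial>lborel)"
    using ch by (intro integral_norm_bound_ennreal borel_integrable_compact) (auto intro: continuous_on_subset)
  \<comment> \<open>The idempotent indicator is doubled so that one copy can be the second factor in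
    Cauchy-Schwarz, where its square integrates to 1.\<close>
  also have "\<dots> = (\<integral>\<^sup>+t. indicator {0..1} t * (indicator {0..1} t * ennreal \<bar>h t\<bar>) \<partial>lborel)"
    by (intro nn_integral_cong) (auto split: split_indicator)
  finally have "ennreal \<bar>f (x + z) - f x\<bar>^2 \<le> (\<integral>\<^sup>+t. indicator {0..1} t * (indicator {0..1} t * ennreal \<bar>h t\<bar>) \<partial>lborel)^2"
    by (intro power_mono) auto
  also have "\<dots> \<le> (\<integral>\<^sup>+t. (indicator {0..1::real} t)^2 \<partial>lborel) * (\<integral>\<^sup>+t. (indicator {0..1} t * ennreal \<bar>h t\<bar>)^2 \<partial>lborel)"
    by (rule Cauchy_Schwarz_nn_integral) auto
  also have "(\<integral>\<^sup>+t. (indicator {0..1::real} t)^2 \<partial>lborel) = (\<integral>\<^sup>+t. indicator {0..1::real} t \<partial>lborel)"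
    by (intro nn_integral_cong) (auto split: split_indicator)
  also have "\<dots> = 1" by simp
  also have "1 * (\<integral>\<^sup>+t. (indicator {0..1} t * ennreal \<bar>h t\<bar>)^2 \<partial>lborel) \<le>
      (\<integral>\<^sup>+t. ennreal ((norm z)\<^sup>2) * (indicator {0..1} t * ennreal ((norm (g (x + t *\<^sub>R z)))\<^sup>2)) \<partial>lborel)"
  proof -
    have "ennreal \<bar>h t\<bar>^2 \<le> ennreal ((norm z)\<^sup>2) * ennreal ((norm (g (x + t *\<^sub>R z)))\<^sup>2)" for t
    proof -
      have "\<bar>h t\<bar> \<le> norm z * norm (g (x + t *\<^sub>R z))"
        unfolding h_def using Cauchy_Schwarz_ineq2[of "g (x + t *\<^sub>R z)" z] by (simp add: mult.commute)
      then have "\<bar>h t\<bar>^2 \<le> (norm z * norm (g (x + t *\<^sub>R z)))^2" by (rule power_mono) auto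
      then show ?thesis
        by (simp add: ennreal_mult[symmetric] ennreal_power power_mult_distrib ennreal_leI)
    qed
    then show ?thesis
      unfolding mult_1 by (intro nn_integral_mono) (auto split: split_indicator)
  qed
  also have "\<dots> = ennreal ((norm z)\<^sup>2) * (\<integral>\<^sup>+t. indicator {0..1} t * ennreal ((norm (g (x + t *\<^sub>R z)))\<^sup>2) \<partial>lborel)"
    by (intro nn_integral_cmult) simp
  finally show ?thesis by (simp add: ennreal_power)
qed

text \<open>The pointwise bound is integrated over x. After exchanging the integrals, each t
  contributes a translate of the same function, so the dependence on t disappears.\<close>

lemma nn_integral_translation_difference_le:
  fixes f :: "real^'n \<Rightarrow> real"
  assumes f: "\<And>x. (f has_derivative (\<lambda>v. g x \<bullet> v)) (at x)" and g: "continuous_on UNIV g"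
  shows "(\<integral>\<^sup>+x. ennreal ((f (x + z) - f x)\<^sup>2) \<partial>lborel) \<le>
    ennreal ((norm z)\<^sup>2) * (\<integral>\<^sup>+x. ennreal ((norm (g x))\<^sup>2) \<partial>lborel)"
proof -
  have [measurable]: "g \<in> borel_measurable borel" using g by (rule borel_measurable_continuous_onI)
  have "(\<integral>\<^sup>+x. ennreal ((f (x + z) - f x)\<^sup>2) \<partial>lborel) \<le>
     (\<integral>\<^sup>+x. ennreal ((norm z)\<^sup>2) * (\<integral>\<^sup>+t. indicator {0..1} t * ennreal ((norm (g (x + t *\<^sub>R z)))\<^sup>2) \<partial>lborel) \<partial>lborel)"
    by (intro nn_integral_mono square_increment_le_nn_integral f g)
  also have "\<dots> = ennreal ((norm z)\<^sup>2) *
     (\<integral>\<^sup>+x. (\<integral>\<^sup>+t. indicator {0..1} t * ennreal ((norm (g (x + t *\<^sub>R z)))\<^sup>2) \<partial>lborel) \<partial>lborel)"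
    by (intro nn_integral_cmult) simp
  also have "(\<integral>\<^sup>+x. (\<integral>\<^sup>+t. indicator {0..1} t * ennreal ((norm (g (x + t *\<^sub>R z)))\<^sup>2) \<partial>lborel) \<partial>lborel) =
     (\<integral>\<^sup>+t. (\<integral>\<^sup>+x. indicator {0..1} t * ennreal ((norm (g (x + t *\<^sub>R z)))\<^sup>2) \<partial>lborel) \<partial>lborel)"
    by (intro lborel_pair.Fubini') simp
  also have "\<dots> = (\<integral>\<^sup>+t. indicator {0..1::real} t * (\<integral>\<^sup>+x. ennreal ((norm (g x))\<^sup>2) \<partial>lborel) \<partial>lborel)"
    by (intro nn_integral_cong, subst nn_integral_cmult, simp,
        subst nn_integral_lborel_translate[of "\<lambda>x. ennreal ((norm (g x))\<^sup>2)"]) auto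
  also have "\<dots> = (\<integral>\<^sup>+x. ennreal ((norm (g x))\<^sup>2) \<partial>lborel)"
    by (subst nn_integral_multc) auto
  finally show ?thesis .
qed

text \<open>Averaging \<open>f(x)\<^sup>2 \<le> (f(x+z) - f(x))\<^sup>2 + 2 \<bar>f(x)\<bar> \<bar>f(x+z)\<bar>\<close> over a cube of
  translations \<open>z\<close>.  Combined with \<open>\<parallel>f\<parallel>\<^sub>1\<^sup>2 \<le> |supp f| \<parallel>f\<parallel>\<^sub>2\<^sup>2\<close> and a cube four times as large
  as the support, this is the Faber-Krahn inequality, which replaces Sobolev's inequality.\<close>

lemma nn_integral_square_le_cube_average:
  fixes f :: "real^'n \<Rightarrow> real" and l :: real
  assumes f: "\<And>x. (f has_derivative (\<lambda>v. g x \<bullet> v)) (at x)" and g: "continuous_on UNIV g" and l: "l \<ge> 0"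
  shows "ennreal (l ^ CARD('n)) * (\<integral>\<^sup>+x. ennreal ((f x)\<^sup>2) \<partial>lborel) \<le>
      ennreal (l ^ CARD('n)) * ennreal (CARD('n) * l\<^sup>2) * (\<integral>\<^sup>+x. ennreal ((norm (g x))\<^sup>2) \<partial>lborel)
      + 2 * (\<integral>\<^sup>+x. ennreal \<bar>f x\<bar> \<partial>lborel)\<^sup>2"
proof -
  define Q where "Q = cbox (0::real^'n) (\<chi> i. l)"
  have [measurable]: "Q \<in> sets borel" by (simp add: Q_def)
  have Q: "emeasure lborel Q = ennreal (l ^ CARD('n))"
    unfolding Q_def using l by (subst emeasure_lborel_cbox_eq) (auto simp: Basis_vec_def inner_axis axis_eq_axis prod.UNION_disjoint)
  have [measurable]: "f \<in> borel_measurable borel"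
    using f by (intro borel_measurable_continuous_onI)
       (meson continuous_at_imp_continuous_on has_derivative_continuous)
  have [measurable]: "g \<in> borel_measurable borel" using g by (rule borel_measurable_continuous_onI)
  let ?F = "\<integral>\<^sup>+x. ennreal ((f x)\<^sup>2) \<partial>lborel" and ?G = "\<integral>\<^sup>+x. ennreal ((norm (g x))\<^sup>2) \<partial>lborel"
  let ?P = "\<lambda>z. \<integral>\<^sup>+x. ennreal \<bar>f x\<bar> * ennreal \<bar>f (x + z)\<bar> \<partial>lborel"
  have norm_Q: "(norm z)\<^sup>2 \<le> CARD('n) * l\<^sup>2" if "z \<in> Q" for z
  proof -
    have "(norm z)\<^sup>2 = (\<Sum>i\<in>UNIV. (z $ i)\<^sup>2)"
      by (simp add: norm_vec_def L2_set_def sum_nonneg)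
    also have "\<dots> \<le> (\<Sum>i\<in>(UNIV::'n set). (l\<^sup>2 :: real))"
      using that by (intro sum_mono power_mono) (auto simp: Q_def mem_box_cart)
    finally show ?thesis by simp
  qed
  have pt: "?F \<le> ennreal (CARD('n) * l\<^sup>2) * ?G + 2 * ?P z" if "z \<in> Q" for z
  proof -
    have "ennreal ((f x)\<^sup>2) \<le> ennreal ((f (x + z) - f x)\<^sup>2) + 2 * (ennreal \<bar>f x\<bar> * ennreal \<bar>f (x + z)\<bar>)" for x
    proof -
      have "(f x)\<^sup>2 \<le> (f (x + z) - f x)\<^sup>2 + 2 * (f x * f (x + z))"
        using zero_le_power2[of "f (x + z)"] by (simp add: power2_eq_square algebra_simps)
      also have "f x * f (x + z) \<le> \<bar>f x\<bar> * \<bar>f (x + z)\<bar>" by (metis abs_ge_self abs_mult)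
      finally have "ennreal ((f x)\<^sup>2) \<le> ennreal ((f (x + z) - f x)\<^sup>2 + 2 * (\<bar>f x\<bar> * \<bar>f (x + z)\<bar>))"
        by (intro ennreal_leI) auto
      then show ?thesis by (simp add: ennreal_mult)
    qed
    then have "?F \<le> (\<integral>\<^sup>+x. ennreal ((f (x + z) - f x)\<^sup>2) + 2 * (ennreal \<bar>f x\<bar> * ennreal \<bar>f (x + z)\<bar>) \<partial>lborel)"
      by (rule nn_integral_mono)
    also have "\<dots> = (\<integral>\<^sup>+x. ennreal ((f (x + z) - f x)\<^sup>2) \<partial>lborel) + 2 * ?P z"
      by (subst nn_integral_add) (auto simp: nn_integral_cmult)
    also have "(\<integral>\<^sup>+x. ennreal ((f (x + z) - f x)\<^sup>2) \<partial>lborel) \<le> ennreal ((norm z)\<^sup>2) * ?G"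
      by (rule nn_integral_translation_difference_le[OF f g])
    also have "\<dots> \<le> ennreal (CARD('n) * l\<^sup>2) * ?G"
      using norm_Q[OF that] by (intro mult_right_mono ennreal_leI) auto
    finally show ?thesis by (simp add: add_right_mono)
  qed
  have "ennreal (l ^ CARD('n)) * ?F = (\<integral>\<^sup>+z. indicator Q z * ?F \<partial>lborel)"
    by (subst nn_integral_multc) (auto simp: Q)
  \<comment> \<open>The product term is integrated over all z and not only over \<open>Q\<close>.
    This enlarges it, but now Tonelli splits it into the square of the L1 norm.\<close>
  also have "\<dots> \<le> (\<integral>\<^sup>+z. indicator Q z * (ennreal (CARD('n) * l\<^sup>2) * ?G) + 2 * ?P z \<partial>lborel)"
    by (intro nn_integral_mono) (use pt in \<open>auto split: split_indicator\<close>)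
  also have "\<dots> = ennreal (l ^ CARD('n)) * (ennreal (CARD('n) * l\<^sup>2) * ?G) + 2 * (\<integral>\<^sup>+z. ?P z \<partial>lborel)"
    by (subst nn_integral_add) (auto simp: nn_integral_multc nn_integral_cmult Q)
  also have "(\<integral>\<^sup>+z. ?P z \<partial>lborel) = (\<integral>\<^sup>+x. \<integral>\<^sup>+z. ennreal \<bar>f x\<bar> * ennreal \<bar>f (x + z)\<bar> \<partial>lborel \<partial>lborel)"
    by (intro lborel_pair.Fubini') simp
  also have "\<dots> = (\<integral>\<^sup>+x. ennreal \<bar>f x\<bar> * (\<integral>\<^sup>+z. ennreal \<bar>f z\<bar> \<partial>lborel) \<partial>lborel)"
    by (intro nn_integral_cong, subst nn_integral_cmult, simp, subst add.commute,
        subst nn_integral_lborel_translate[of "\<lambda>x. ennreal \<bar>f x\<bar>"]) auto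
  also have "\<dots> = (\<integral>\<^sup>+x. ennreal \<bar>f x\<bar> \<partial>lborel)\<^sup>2"
    by (subst nn_integral_multc) (auto simp: power2_eq_square)
  finally show ?thesis by (simp add: mult.assoc)
qed

text \<open>Translations act on the whole space, the differential inequality lives on \<Omega>. For
  bounded functions vanishing off \<Omega> the two kinds of integral agree.\<close>

lemma nn_integral_lborel_eq_integral_lebesgue_on:
  fixes h :: "real^'n \<Rightarrow> real"
  assumes "open \<Omega>" "bounded \<Omega>" and h: "continuous_on UNIV h" "\<And>x. 0 \<le> h x" "\<And>x. h x \<le> B" "\<And>x. x \<notin> \<Omega> \<Longrightarrow> h x = 0"
  shows "(\<integral>\<^sup>+x. ennreal (h x) \<partial>lborel) = ennreal (\<integral>x. h x \<partial>lebesgue_on \<Omega>)"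
proof -
  have [measurable]: "h \<in> borel_measurable borel" by (rule borel_measurable_continuous_onI[OF h(1)])
  have \<Omega>: "\<Omega> \<in> sets lebesgue" "\<Omega> \<in> sets lborel" using \<open>open \<Omega>\<close> by auto
  have ind: "indicator \<Omega> x * h x = h x" for x using h(4)[of x] by (auto split: split_indicator)
  have int: "integrable lborel h"
  proof (rule Bochner_Integration.integrable_bound)
    show "integrable lborel (\<lambda>x. B * indicator \<Omega> x)"
      using emeasure_bounded_finite[OF \<open>bounded \<Omega>\<close>] \<Omega> by (auto intro!: integrable_mult_right integrable_real_indicator)
    show "AE x in lborel. norm (h x) \<le> norm (B * indicator \<Omega> x)"
      using h(2,3,4) by (intro AE_I2) (auto split: split_indicator intro: order_trans[OF _ abs_ge_self])
  qed simp
  have "(\<integral>\<^sup>+x. ennreal (h x) \<partial>lborel) = ennreal (\<integral>x. h x \<partial>lborel)"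
    using int h(2) by (intro nn_integral_eq_integral) auto
  also have "(\<integral>x. h x \<partial>lborel) = (\<integral>x. h x \<partial>lebesgue_on \<Omega>)"
    by (subst integral_lebesgue_on_eq[OF \<Omega>(1)]) (simp add: ind integral_completion)
  finally show ?thesis .
qed

section \<open>Approximation of functions with zero boundary values\<close>

lemma borel_measurable_lebesgue_on_continuous:
  fixes h :: "'a::euclidean_space \<Rightarrow> 'b::topological_space"
  assumes "continuous_on UNIV h"
  shows "h \<in> borel_measurable (lebesgue_on \<Omega>)"
proof -
  have "h \<in> borel_measurable lborel"
    using borel_measurable_continuous_onI[OF assms] by simp
  then show ?thesis by (intro measurable_restrict_space1 measurable_completion)
qed

lemma borel_measurable_vec_nth [measurable (raw)]:
  fixes F :: "'a \<Rightarrow> real^'n"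
  assumes "F \<in> borel_measurable M"
  shows "(\<lambda>x. F x $ i) \<in> borel_measurable M"
proof -
  have "(\<lambda>v :: real^'n. v $ i) \<in> borel_measurable borel"
    by (intro borel_measurable_continuous_onI continuous_intros)
  from measurable_compose[OF assms this] show ?thesis .
qed

text \<open>Hoelder's inequality with an indicator as second factor. It yields the power 1 - 1/p of
  the measure of a superlevel set.\<close>

lemma Holder_on_subset:
  fixes f :: "'a \<Rightarrow> real"
  assumes p: "p > 1" and f: "f \<in> borel_measurable M" "integrable M (\<lambda>x. \<bar>f x\<bar> powr p)"
    and A: "A \<in> sets M" "emeasure M A < \<infinity>"
  shows "integrable M (\<lambda>x. indicator A x * \<bar>f x\<bar>)"
    and "(\<integral>x. indicator A x * \<bar>f x\<bar> \<partial>M) \<le> (\<integral>x. \<bar>f x\<bar> powr p \<partial>M) powr (1/p) * measure M A powr (1 - 1/p)"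
proof -
  define I where "I = (\<integral>x. \<bar>f x\<bar> powr p \<partial>M)"
  define a where "a = measure M A"
  define q where "q = p / (p - 1)"
  have q: "q > 1" "1/p + 1/q = 1" "1/q = 1 - 1/p" using p by (auto simp: q_def field_simps)
  have iA: "integrable M (\<lambda>x. indicator A x :: real)" using A by (simp add: integrable_real_indicator)
  have [measurable]: "A \<in> sets M" "f \<in> borel_measurable M" using A f by auto
  show int: "integrable M (\<lambda>x. indicator A x * \<bar>f x\<bar>)"
  proof (rule Bochner_Integration.integrable_bound[where f = "\<lambda>x. \<bar>f x\<bar> powr p / p + indicator A x / q"])
    show "AE x in M. norm (indicator A x * \<bar>f x\<bar>) \<le> norm (\<bar>f x\<bar> powr p / p + indicator A x / q)"
    proof (rule AE_I2)
      fix x show "norm (indicator A x * \<bar>f x\<bar>) \<le> norm (\<bar>f x\<bar> powr p / p + indicator A x / q)"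
        using Youngs_inequality[OF p q(1,2), of "\<bar>f x\<bar>" 1] by (auto split: split_indicator)
    qed
  qed (use f iA in auto)
  show "(\<integral>x. indicator A x * \<bar>f x\<bar> \<partial>M) \<le> (\<integral>x. \<bar>f x\<bar> powr p \<partial>M) powr (1/p) * measure M A powr (1 - 1/p)"
  proof (cases "I = 0 \<or> a = 0")
    case True
    then have "AE x in M. indicator A x * \<bar>f x\<bar> = 0"
    proof
      assume "I = 0"
      then have "AE x in M. \<bar>f x\<bar> powr p = 0"
        using integral_nonneg_eq_0_iff_AE[OF f(2)] by (auto simp: I_def)
      then show ?thesis by eventually_elim auto
    next
      assume "a = 0"
      then have "emeasure M A = 0" using A by (simp add: a_def emeasure_eq_ennreal_measure)
      then have "A \<in> null_sets M" using A by auto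
      from AE_not_in[OF this] show ?thesis by eventually_elim auto
    qed
    then have "(\<integral>x. indicator A x * \<bar>f x\<bar> \<partial>M) = (\<integral>x. 0 \<partial>M)"
      by (intro integral_cong_AE) auto
    then show ?thesis by (simp add: mult_nonneg_nonneg)
  next
    case False
    have "I \<ge> 0" "a \<ge> 0" unfolding I_def a_def by (auto intro: integral_nonneg)
    with False have I: "I > 0" and a: "a > 0" by auto
    \<comment> \<open>Both factors are divided by their norms, after which Young's inequality
      integrates to 1/p + 1/q = 1. The vanishing of a norm had to be treated separately.\<close>
    define \<alpha> where "\<alpha> = I powr (1/p)"
    define \<beta> where "\<beta> = a powr (1/q)"
    have \<alpha>: "\<alpha> > 0" "\<alpha> powr p = I" using I p by (auto simp: \<alpha>_def powr_powr)
    have \<beta>: "\<beta> > 0" "\<beta> powr q = a" using a q(1) by (auto simp: \<beta>_def powr_powr)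
    have "(\<integral>x. indicator A x * \<bar>f x\<bar> \<partial>M) \<le> (\<integral>x. \<alpha> * \<beta> * (\<bar>f x\<bar> powr p / (I * p) + indicator A x / (a * q)) \<partial>M)"
    proof (rule integral_mono[OF int])
      fix x
      have "\<bar>f x\<bar> / \<alpha> * (1 / \<beta>) \<le> (\<bar>f x\<bar> / \<alpha>) powr p / p + (1 / \<beta>) powr q / q"
        using \<alpha> \<beta> by (intro Youngs_inequality p q) auto
      also have "\<dots> = \<bar>f x\<bar> powr p / (I * p) + 1 / (a * q)"
        using \<alpha> \<beta> by (simp add: powr_divide)
      finally have "\<bar>f x\<bar> \<le> \<alpha> * \<beta> * (\<bar>f x\<bar> powr p / (I * p) + 1 / (a * q))"
        using \<alpha>(1) \<beta>(1) by (simp add: field_simps)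
      then show "indicator A x * \<bar>f x\<bar> \<le> \<alpha> * \<beta> * (\<bar>f x\<bar> powr p / (I * p) + indicator A x / (a * q))"
        using \<alpha>(1) \<beta>(1) I p by (auto split: split_indicator)
    qed (use f iA in auto)
    also have "\<dots> = \<alpha> * \<beta> * (I / (I * p) + a / (a * q))"
      using f iA by (simp add: I_def a_def)
    also have "\<dots> = \<alpha> * \<beta>" using I a p q by simp
    finally show ?thesis by (simp add: \<alpha>_def \<beta>_def I_def a_def q)
  qed
qed

lemma integrable_mult_bounded:
  fixes X b :: "'a \<Rightarrow> real"
  assumes X: "integrable M X" and b: "b \<in> borel_measurable M" "\<And>x. \<bar>b x\<bar> \<le> B"
  shows "integrable M (\<lambda>x. X x * b x)"
proof (rule Bochner_Integration.integrable_bound[OF integrable_mult_left[OF X, of B]])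
  have [measurable]: "X \<in> borel_measurable M" using X by simp
  show "(\<lambda>x. X x * b x) \<in> borel_measurable M" using b(1) by measurable
  show "AE x in M. norm (X x * b x) \<le> norm (X x * B)"
    unfolding real_norm_def abs_mult
    by (intro AE_I2 mult_left_mono order_trans[OF b(2) abs_ge_self]) auto
qed

lemma (in finite_measure) integrable_of_square:
  fixes f :: "'a \<Rightarrow> real"
  assumes "f \<in> borel_measurable M" "integrable M (\<lambda>x. (f x)\<^sup>2)"
  shows "integrable M f"
proof (rule Bochner_Integration.integrable_bound)
  show "integrable M (\<lambda>x. 1 + (f x)\<^sup>2)" using assms by simp
  have "\<bar>t\<bar> \<le> 1 + t\<^sup>2" for t :: real
    using zero_le_power2[of "\<bar>t\<bar> - 1"] by (auto simp: power2_eq_square algebra_simps)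
  then show "AE x in M. norm (f x) \<le> norm (1 + (f x)\<^sup>2)" by auto
qed (use assms in auto)

lemma Lp_2_iff: "Lp \<Omega> 2 f \<longleftrightarrow> f \<in> borel_measurable (lebesgue_on \<Omega>) \<and> integrable (lebesgue_on \<Omega>) (\<lambda>x. (f x)\<^sup>2)"
proof -
  have "\<bar>t\<bar> powr 2 = t\<^sup>2" for t :: real
    by (cases "t = 0") (auto simp: powr_realpow[of "\<bar>t\<bar>" 2, simplified])
  then show ?thesis by (simp add: Lp_def)
qed

lemma H1_gradD:
  assumes "H1_grad \<Omega> u G"
  shows "u \<in> borel_measurable (lebesgue_on \<Omega>)" "integrable (lebesgue_on \<Omega>) (\<lambda>x. (u x)\<^sup>2)"
    "G \<in> borel_measurable (lebesgue_on \<Omega>)" "integrable (lebesgue_on \<Omega>) (\<lambda>x. (norm (G x))\<^sup>2)"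
proof -
  have *: "(norm (G x))\<^sup>2 = (\<Sum>i\<in>UNIV. (G x $ i)\<^sup>2)" for x
    by (simp add: norm_vec_def L2_set_def sum_nonneg)
  show "u \<in> borel_measurable (lebesgue_on \<Omega>)" "integrable (lebesgue_on \<Omega>) (\<lambda>x. (u x)\<^sup>2)"
    using assms by (auto simp: H1_grad_def Lp_2_iff)
  show "integrable (lebesgue_on \<Omega>) (\<lambda>x. (norm (G x))\<^sup>2)"
    unfolding * using assms by (auto simp: H1_grad_def Lp_2_iff)
  have "(\<lambda>x. G x $ i) \<in> borel_measurable (lebesgue_on \<Omega>)" for i
    using assms by (auto simp: H1_grad_def Lp_2_iff)
  then show "G \<in> borel_measurable (lebesgue_on \<Omega>)"
    by (subst borel_measurable_euclidean_space) (auto simp: Basis_vec_def inner_axis)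
qed

text \<open>This lets an integrable bound on squared gradients dominate the gradients themselves;
  the constant 1 is integrable because \<Omega> has finite measure.\<close>

lemma component_le_one_plus_norm_square: "\<bar>v $ i\<bar> \<le> 1 + (norm v)\<^sup>2"
proof -
  have "\<bar>v $ i\<bar> \<le> norm v" by (rule component_le_norm_cart)
  also have "norm v \<le> 1 + (norm v)\<^sup>2"
    using zero_le_power2[of "norm v - 1"] norm_ge_zero[of v]
    by (simp add: power2_eq_square algebra_simps del: norm_ge_zero)
  finally show ?thesis .
qed

text \<open>Convergence in mean square is replaced by convergence almost everywhere together with
  one integrable majorant of all the squares. In this form nonlinear functions of the approximants
  pass to the limit by dominated convergence.\<close>

locale dominated_approximation =
  fixes \<Omega> :: "(real^'n) set" and U :: "real^'n \<Rightarrow> real" and V :: "real^'n \<Rightarrow> real^'n"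
    and f :: "nat \<Rightarrow> real^'n \<Rightarrow> real" and g :: "nat \<Rightarrow> real^'n \<Rightarrow> real^'n" and H :: "real^'n \<Rightarrow> real"
  assumes open_\<Omega>: "open \<Omega>" and bounded_\<Omega>: "bounded \<Omega>"
    and U_grad: "H1_grad \<Omega> U V"
    and test: "\<And>i. test_fun \<Omega> (f i)"
    and grad: "\<And>i x. (f i has_derivative (\<lambda>v. g i x \<bullet> v)) (at x)"
    and H: "integrable (lebesgue_on \<Omega>) H"
    and approx: "AE x in lebesgue_on \<Omega>. (\<forall>i. (f i x)\<^sup>2 \<le> H x \<and> (norm (g i x))\<^sup>2 \<le> H x) \<and>
      (\<lambda>i. f i x) \<longlonglongrightarrow> U x \<and> (\<lambda>i. g i x) \<longlonglongrightarrow> V x"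

text \<open>The subsequence principle is applied to the squared errors of the functions and of their
  gradients taken together, so that one subsequence serves both.\<close>

lemma dominated_approximation_exists:
  fixes \<Omega> :: "(real^'n) set"
  assumes \<Omega>: "open \<Omega>" "bounded \<Omega>" and U: "H10 \<Omega> U"
  obtains V f g H where "dominated_approximation \<Omega> U V f g H"
proof -
  let ?M = "lebesgue_on \<Omega>"
  have \<Omega>m: "\<Omega> \<in> sets lebesgue" using \<Omega> by auto
  interpret finite_measure ?M by (intro finite_measure_lebesgue_on bounded_set_imp_lmeasurable \<Omega> \<Omega>m)
  obtain V \<phi> \<gamma> where V: "H1_grad \<Omega> U V"
    and \<phi>: "\<And>k. test_fun \<Omega> (\<phi> k)" "\<And>k x. (\<phi> k has_derivative (\<lambda>w. \<gamma> k x \<bullet> w)) (at x)"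
    and lim: "(\<lambda>k. \<integral>x. (\<phi> k x - U x)\<^sup>2 \<partial>?M) \<longlonglongrightarrow> 0" "(\<lambda>k. \<integral>x. (norm (\<gamma> k x - V x))\<^sup>2 \<partial>?M) \<longlonglongrightarrow> 0"
    using U unfolding H10_def by blast
  note UV = H1_gradD[OF V]
  have [measurable]: "U \<in> borel_measurable ?M" "V \<in> borel_measurable ?M" using UV by auto
  have [measurable]: "\<phi> k \<in> borel_measurable ?M" "\<gamma> k \<in> borel_measurable ?M" for k
    using borel_measurable_lebesgue_on_continuous test_fun_continuous[OF \<phi>(1)]
      test_fun_gradient_continuous[OF \<phi>] by auto
  have sq: "(norm (a - b))\<^sup>2 \<le> 2 * (norm a)\<^sup>2 + 2 * (norm b)\<^sup>2" for a b :: "'a::real_normed_vector"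
  proof -
    have "(norm (a - b))\<^sup>2 \<le> (norm a + norm b)\<^sup>2" by (intro power_mono norm_triangle_ineq4) auto
    also have "\<dots> \<le> 2 * (norm a)\<^sup>2 + 2 * (norm b)\<^sup>2"
      using zero_le_power2[of "norm a - norm b"] by (simp add: power2_eq_square algebra_simps)
    finally show ?thesis .
  qed
  \<comment> \<open>The Bochner integral of a non-integrable function is 0 by convention, so the
    limits in \<open>H10\<close> carry information only once the squared errors are known to be
    integrable.\<close>
  have int1: "integrable ?M (\<lambda>x. (\<phi> k x - U x)\<^sup>2)" for k
  proof -
    obtain B where B: "\<And>x. \<bar>\<phi> k x\<bar> \<le> B" using test_fun_bounded[OF \<phi>(1)] by metis
    show ?thesis
    proof (rule Bochner_Integration.integrable_bound)
      show "integrable ?M (\<lambda>x. 2 * B\<^sup>2 + 2 * (U x)\<^sup>2)" using UV by simp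
      have "(\<phi> k x - U x)\<^sup>2 \<le> 2 * B\<^sup>2 + 2 * (U x)\<^sup>2" for x
        using sq[of "\<phi> k x" "U x"] power_mono[OF B[of x], of 2] by simp
      then show "AE x in ?M. norm ((\<phi> k x - U x)\<^sup>2) \<le> norm (2 * B\<^sup>2 + 2 * (U x)\<^sup>2)" by simp
    qed simp
  qed
  have int2: "integrable ?M (\<lambda>x. (norm (\<gamma> k x - V x))\<^sup>2)" for k
  proof -
    obtain B where B: "\<And>x. norm (\<gamma> k x) \<le> B" using test_fun_gradient_bounded[OF \<phi>] by metis
    show ?thesis
    proof (rule Bochner_Integration.integrable_bound)
      show "integrable ?M (\<lambda>x. 2 * B\<^sup>2 + 2 * (norm (V x))\<^sup>2)" using UV by simp
      have "(norm (\<gamma> k x - V x))\<^sup>2 \<le> 2 * B\<^sup>2 + 2 * (norm (V x))\<^sup>2" for x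
        using sq[of "\<gamma> k x" "V x"] power_mono[OF B[of x], of 2] by simp
      then show "AE x in ?M. norm ((norm (\<gamma> k x - V x))\<^sup>2) \<le> norm (2 * B\<^sup>2 + 2 * (norm (V x))\<^sup>2)" by simp
    qed simp
  qed
  define d where "d k x = (\<phi> k x - U x)\<^sup>2 + (norm (\<gamma> k x - V x))\<^sup>2" for k x
  have "(\<lambda>k. \<integral>x. d k x \<partial>?M) \<longlonglongrightarrow> 0"
    unfolding d_def using tendsto_add[OF lim] by (simp add: int1 int2)
  then obtain r S where S: "integrable ?M S"
    "AE x in ?M. (\<forall>i. d (r i) x \<le> S x) \<and> (\<lambda>i. d (r i) x) \<longlonglongrightarrow> 0"
    by (rule L1_null_sequence_dominated_subseq[rotated 2]) (auto simp: d_def int1 int2)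
  \<comment> \<open>The majorant comes from (a + b)^2 \<le> 2 a^2 + 2 b^2, with the error bounded by
    \<open>S\<close> and the limits \<open>U\<close> and \<open>V\<close> themselves.\<close>
  have "dominated_approximation \<Omega> U V (\<lambda>i. \<phi> (r i)) (\<lambda>i. \<gamma> (r i))
      (\<lambda>x. 2 * S x + 2 * (U x)\<^sup>2 + 2 * (norm (V x))\<^sup>2)"
  proof
    show "integrable ?M (\<lambda>x. 2 * S x + 2 * (U x)\<^sup>2 + 2 * (norm (V x))\<^sup>2)"
      using S UV by simp
    show "AE x in ?M. (\<forall>i. (\<phi> (r i) x)\<^sup>2 \<le> 2 * S x + 2 * (U x)\<^sup>2 + 2 * (norm (V x))\<^sup>2 \<and>
        (norm (\<gamma> (r i) x))\<^sup>2 \<le> 2 * S x + 2 * (U x)\<^sup>2 + 2 * (norm (V x))\<^sup>2) \<and>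
      (\<lambda>i. \<phi> (r i) x) \<longlonglongrightarrow> U x \<and> (\<lambda>i. \<gamma> (r i) x) \<longlonglongrightarrow> V x"
      using S(2)
    proof eventually_elim
      case (elim x)
      have le: "(\<phi> (r i) x - U x)\<^sup>2 \<le> S x" "(norm (\<gamma> (r i) x - V x))\<^sup>2 \<le> S x" for i
        using elim zero_le_power2 unfolding d_def by (smt (verit))+
      have "(\<phi> (r i) x)\<^sup>2 \<le> 2 * (\<phi> (r i) x - U x)\<^sup>2 + 2 * (U x)\<^sup>2"
        "(norm (\<gamma> (r i) x))\<^sup>2 \<le> 2 * (norm (\<gamma> (r i) x - V x))\<^sup>2 + 2 * (norm (V x))\<^sup>2" for i
        using sq[of "\<phi> (r i) x - U x" "- U x"] sq[of "\<gamma> (r i) x - V x" "- V x"] by auto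
      then have bounds: "\<forall>i. (\<phi> (r i) x)\<^sup>2 \<le> 2 * S x + 2 * (U x)\<^sup>2 + 2 * (norm (V x))\<^sup>2 \<and>
        (norm (\<gamma> (r i) x))\<^sup>2 \<le> 2 * S x + 2 * (U x)\<^sup>2 + 2 * (norm (V x))\<^sup>2"
        using le zero_le_power2[of "U x"] zero_le_power2[of "norm (V x)"] by (smt (verit))
      have lim: "(\<lambda>i. d (r i) x) \<longlonglongrightarrow> 0" using elim by simp
      have "(\<lambda>i. (\<phi> (r i) x - U x)\<^sup>2) \<longlonglongrightarrow> 0" "(\<lambda>i. (norm (\<gamma> (r i) x - V x))\<^sup>2) \<longlonglongrightarrow> 0"
        by (rule tendsto_sandwich[OF _ _ tendsto_const lim]; simp add: d_def)+
      then have "(\<lambda>i. \<phi> (r i) x - U x) \<longlonglongrightarrow> 0" "(\<lambda>i. norm (\<gamma> (r i) x - V x)) \<longlonglongrightarrow> 0"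
        by (simp_all add: power_tendsto_0_iff)
      then show ?case
        using bounds by (auto simp: tendsto_norm_zero_iff LIM_zero_iff)
    qed
  qed (use \<Omega> V \<phi> in auto)
  then show ?thesis by (rule that)
qed

section \<open>Limit passages, and the gradient where the solution is negative\<close>

context dominated_approximation
begin

abbreviation "M\<^sub>\<Omega> \<equiv> lebesgue_on \<Omega>"

lemma \<Omega>_sets: "\<Omega> \<in> sets lebesgue"
  using open_\<Omega> by auto

sublocale finite_measure "lebesgue_on \<Omega>"
  by (intro finite_measure_lebesgue_on bounded_set_imp_lmeasurable bounded_\<Omega> \<Omega>_sets)

lemmas UV = H1_gradD[OF U_grad]

lemma measurable_UV [measurable]: "U \<in> borel_measurable M\<^sub>\<Omega>" "V \<in> borel_measurable M\<^sub>\<Omega>"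
  using UV by auto

lemma measurable_fg [measurable]: "f i \<in> borel_measurable M\<^sub>\<Omega>" "g i \<in> borel_measurable M\<^sub>\<Omega>"
  using borel_measurable_lebesgue_on_continuous test_fun_continuous[OF test]
    test_fun_gradient_continuous[OF test grad] by auto

lemma measurable_flat [measurable]: "flat p \<in> borel_measurable borel"
  by (rule borel_measurable_continuous_onI[OF continuous_flat])

lemma tendsto_flat_compose: "(\<lambda>i. a i) \<longlonglongrightarrow> b \<Longrightarrow> (\<lambda>i. flat p ((a i - k) / s)) \<longlonglongrightarrow> flat p ((b - k) / s)"
  unfolding divide_inverse
  by (rule continuous_on_tendsto_compose[OF continuous_flat]) (auto intro!: tendsto_intros)

lemma integral_flat_tendsto:
  assumes X: "integrable M\<^sub>\<Omega> X"
  shows "(\<lambda>i. \<integral>x. X x * flat p ((f i x - k) / s) \<partial>M\<^sub>\<Omega>) \<longlonglongrightarrow> (\<integral>x. X x * flat p ((U x - k) / s) \<partial>M\<^sub>\<Omega>)"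
proof -
  obtain B where B: "B \<ge> 0" "\<And>t. \<bar>flat p t\<bar> \<le> B" using bounded_flat by metis
  have [measurable]: "X \<in> borel_measurable M\<^sub>\<Omega>" using X by simp
  show ?thesis
  proof (rule integral_dominated_convergence[where w = "\<lambda>x. \<bar>X x\<bar> * B"])
    show "AE x in M\<^sub>\<Omega>. (\<lambda>i. X x * flat p ((f i x - k) / s)) \<longlonglongrightarrow> X x * flat p ((U x - k) / s)"
      using approx by eventually_elim (auto intro!: tendsto_intros tendsto_flat_compose)
  qed (use X B in \<open>auto simp: abs_mult intro!: mult_left_mono\<close>)
qed

text \<open>By Cauchy-Schwarz and Young the integrand is bounded by a constant times |Y|^2 + H. This
  is the limit passage for the term containing \<open>A\<close>, with Y = A Du.\<close>

lemma integral_flat_gradient_tendsto: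
  assumes Y: "Y \<in> borel_measurable M\<^sub>\<Omega>" "integrable M\<^sub>\<Omega> (\<lambda>x. (norm (Y x))\<^sup>2)"
  shows "(\<lambda>i. \<integral>x. flat p ((f i x - k) / s) * (Y x \<bullet> g i x) \<partial>M\<^sub>\<Omega>) \<longlonglongrightarrow>
    (\<integral>x. flat p ((U x - k) / s) * (Y x \<bullet> V x) \<partial>M\<^sub>\<Omega>)"
proof -
  obtain B where B: "B \<ge> 0" "\<And>t. \<bar>flat p t\<bar> \<le> B" using bounded_flat by metis
  have [measurable]: "Y \<in> borel_measurable M\<^sub>\<Omega>" using Y by simp
  have inner_le: "\<bar>a \<bullet> b\<bar> \<le> (norm a)\<^sup>2 + (norm b)\<^sup>2" for a b :: "real^'n"
  proof -
    have "\<bar>a \<bullet> b\<bar> \<le> norm a * norm b" by (rule Cauchy_Schwarz_ineq2)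
    also have "\<dots> \<le> (norm a)\<^sup>2 + (norm b)\<^sup>2"
      using zero_le_power2[of "norm a - norm b"] mult_nonneg_nonneg[OF norm_ge_zero[of a] norm_ge_zero[of b]]
      unfolding power2_eq_square by (simp add: algebra_simps del: mult_nonneg_nonneg)
    finally show ?thesis .
  qed
  show ?thesis
  proof (rule integral_dominated_convergence[where w = "\<lambda>x. B * ((norm (Y x))\<^sup>2 + H x)"])
    show "AE x in M\<^sub>\<Omega>. (\<lambda>i. flat p ((f i x - k) / s) * (Y x \<bullet> g i x)) \<longlonglongrightarrow> flat p ((U x - k) / s) * (Y x \<bullet> V x)"
      using approx by eventually_elim (auto intro!: tendsto_intros tendsto_flat_compose)
    show "AE x in M\<^sub>\<Omega>. norm (flat p ((f i x - k) / s) * (Y x \<bullet> g i x)) \<le> B * ((norm (Y x))\<^sup>2 + H x)" for i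
      using approx
    proof eventually_elim
      case (elim x)
      have "\<bar>Y x \<bullet> g i x\<bar> \<le> (norm (Y x))\<^sup>2 + H x"
        using inner_le[of "Y x" "g i x"] elim by (smt (verit))
      then show ?case using B by (auto simp: abs_mult intro!: mult_mono)
    qed
  qed (use Y H in auto)
qed

text \<open>Both \<open>u\<close> and \<open>U\<close> are tested with approximants of \<open>e\<^sup>-\<^sup>1\<^sup>/\<^sup>U \<eta>\<close>; since \<open>u + U\<close> vanishes
  where \<open>U > 0\<close>, the sum of the two identities leaves only the gradients.\<close>

lemma gradient_eq_on_negative_set:
  assumes u: "H1_grad \<Omega> u G" "Linf \<Omega> u" and U_eq: "\<And>x. U x = neg_part (u x)"
  shows "AE x in M\<^sub>\<Omega>. U x > 0 \<longrightarrow> G x = - V x"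
proof -
  note uG = H1_gradD[OF u(1)]
  have [measurable]: "u \<in> borel_measurable M\<^sub>\<Omega>" "G \<in> borel_measurable M\<^sub>\<Omega>" using uG by auto
  obtain C where C: "AE x in M\<^sub>\<Omega>. \<bar>u x\<bar> \<le> C" using u(2) by (auto simp: Linf_def)
  have intG: "integrable M\<^sub>\<Omega> (\<lambda>x. G x $ i)" "integrable M\<^sub>\<Omega> (\<lambda>x. V x $ i)" for i
    using u(1) U_grad by (auto simp: H1_grad_def Lp_2_iff intro: integrable_of_square)
  let ?q = "flat_deriv 1"
  \<comment> \<open>The weight is positive exactly where U > 0, so it localises the claim to that
    set while remaining accessible to smooth test functions.\<close>
  have eq: "AE x in M\<^sub>\<Omega>. (G x $ i + V x $ i) * flat 1 (U x) = 0" for i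
  proof (rule AE_zero_of_integral_test_fun_zero[OF open_\<Omega>])
    obtain B where B: "B \<ge> 0" "\<And>t. \<bar>flat 1 t\<bar> \<le> B" using bounded_flat by metis
    have GV: "integrable M\<^sub>\<Omega> (\<lambda>x. G x $ i + V x $ i)" using intG by simp
    show "integrable M\<^sub>\<Omega> (\<lambda>x. (G x $ i + V x $ i) * flat 1 (U x))"
      by (rule integrable_mult_bounded[OF GV _ B(2)]) measurable
    fix \<eta> assume \<eta>: "test_fun \<Omega> \<eta>"
    obtain e where e: "\<And>x. (\<eta> has_derivative (\<lambda>v. e x \<bullet> v)) (at x)"
      using \<eta> smooth_fun_gradient unfolding test_fun_def by metis
    obtain B\<eta> where B\<eta>: "\<And>x. \<bar>\<eta> x\<bar> \<le> B\<eta>" "B\<eta> \<ge> 0" using test_fun_bounded[OF \<eta>] by metis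
    obtain Be where Be: "\<And>x. norm (e x) \<le> Be" "Be \<ge> 0" using test_fun_gradient_bounded[OF \<eta> e] by metis
    obtain B' where B': "B' \<ge> 0" "\<And>t. \<bar>flat ?q t\<bar> \<le> B'" using bounded_flat by metis
    have [measurable]: "\<eta> \<in> borel_measurable M\<^sub>\<Omega>" "e \<in> borel_measurable M\<^sub>\<Omega>"
      using borel_measurable_lebesgue_on_continuous test_fun_continuous[OF \<eta>]
        test_fun_gradient_continuous[OF \<eta> e] by auto
    \<comment> \<open>\<open>D j\<close> is the i-th partial derivative of the test function
      \<open>flat 1 (f j x) * \<eta> x\<close>, and \<open>D0\<close> is its pointwise
      limit.\<close>
    define D where "D j x = flat ?q (f j x) * \<eta> x * g j x $ i + flat 1 (f j x) * e x $ i" for j x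
    define D0 where "D0 x = flat ?q (U x) * \<eta> x * V x $ i + flat 1 (U x) * e x $ i" for x
    define w where "w x = B' * B\<eta> * (1 + H x) + B * Be" for x
    have w_int: "integrable M\<^sub>\<Omega> w" unfolding w_def using H by simp
    have [measurable]: "D j \<in> borel_measurable M\<^sub>\<Omega>" "D0 \<in> borel_measurable M\<^sub>\<Omega>" for j
      unfolding D_def D0_def by measurable
    have D_le: "AE x in M\<^sub>\<Omega>. \<forall>j. \<bar>D j x\<bar> \<le> w x"
      using approx
    proof eventually_elim
      case (elim x)
      have "\<bar>D j x\<bar> \<le> w x" for j
      proof -
        have "\<bar>g j x $ i\<bar> \<le> 1 + H x"
          using component_le_one_plus_norm_square[of "g j x" i] elim by (smt (verit))
        then have "\<bar>flat ?q (f j x) * \<eta> x * g j x $ i\<bar> \<le> B' * B\<eta> * (1 + H x)"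
          unfolding abs_mult using B' B\<eta> by (intro mult_mono) auto
        moreover have "\<bar>flat 1 (f j x) * e x $ i\<bar> \<le> B * Be"
          unfolding abs_mult using B Be by (intro mult_mono) (auto intro: order_trans[OF component_le_norm_cart])
        ultimately show ?thesis unfolding D_def w_def by linarith
      qed
      then show ?case by blast
    qed
    have D_int: "integrable M\<^sub>\<Omega> (\<lambda>x. v x * D j x)"
      if v: "v \<in> borel_measurable M\<^sub>\<Omega>" "AE x in M\<^sub>\<Omega>. \<bar>v x\<bar> \<le> C" for v j
    proof (rule Bochner_Integration.integrable_bound[OF integrable_mult_right[OF w_int, of C]])
      show "AE x in M\<^sub>\<Omega>. norm (v x * D j x) \<le> norm (C * w x)"
        using v(2) D_le
      proof eventually_elim
        case (elim x)
        have "\<bar>v x * D j x\<bar> \<le> C * w x" unfolding abs_mult using elim by (intro mult_mono) auto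
        then show ?case by simp
      qed
    qed (use v in measurable)
    have UC: "AE x in M\<^sub>\<Omega>. \<bar>U x\<bar> \<le> C"
      using C by eventually_elim (auto simp: U_eq neg_part_def)
    have flat_int: "integrable M\<^sub>\<Omega> (\<lambda>x. v x * (flat 1 (f j x) * \<eta> x))" if "integrable M\<^sub>\<Omega> v" for v j
    proof (rule integrable_mult_bounded[OF that])
      show "\<bar>flat 1 (f j x) * \<eta> x\<bar> \<le> B * B\<eta>" for x
        unfolding abs_mult using B B\<eta> by (intro mult_mono) auto
    qed measurable
    \<comment> \<open>The expression is written with k = 0 and s = 1 so that it matches the shape
      required by \<open>integral_flat_tendsto\<close>.\<close>
    have ident: "(\<integral>x. (u x + U x) * D j x \<partial>M\<^sub>\<Omega>) = - (\<integral>x. (G x $ i + V x $ i) * \<eta> x * flat 1 ((f j x - 0) / 1) \<partial>M\<^sub>\<Omega>)" for j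
    proof -
      define \<phi> where "\<phi> x = flat 1 ((f j x - 0) / 1) * \<eta> x" for x
      have \<phi>: "test_fun \<Omega> \<phi>"
        unfolding \<phi>_def using \<eta> by (intro test_fun_mult_right test_fun_flat test) (auto simp: test_fun_def)
      have "(\<phi> has_derivative (\<lambda>v. ((flat ?q (f j x) * \<eta> x) *\<^sub>R g j x + flat 1 (f j x) *\<^sub>R e x) \<bullet> v)) (at x)" for x
        unfolding \<phi>_def
        by (rule has_derivative_eq_rhs, rule has_derivative_mult[OF has_derivative_flat_affine[OF grad] e])
           (simp add: fun_eq_iff inner_add_left algebra_simps)
      then have wg: "(\<integral>x. v x * D j x \<partial>M\<^sub>\<Omega>) = - (\<integral>x. W x $ i * (flat 1 (f j x) * \<eta> x) \<partial>M\<^sub>\<Omega>)"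
        if "H1_grad \<Omega> v W" for v W
        using that \<phi> unfolding H1_grad_def weak_grad_def by (fastforce simp: \<phi>_def D_def algebra_simps)
      have "(\<integral>x. (u x + U x) * D j x \<partial>M\<^sub>\<Omega>) = (\<integral>x. u x * D j x \<partial>M\<^sub>\<Omega>) + (\<integral>x. U x * D j x \<partial>M\<^sub>\<Omega>)"
        using D_int C UC by (subst Bochner_Integration.integral_add[symmetric]) (auto simp: algebra_simps)
      also have "\<dots> = - ((\<integral>x. G x $ i * (flat 1 (f j x) * \<eta> x) \<partial>M\<^sub>\<Omega>) + (\<integral>x. V x $ i * (flat 1 (f j x) * \<eta> x) \<partial>M\<^sub>\<Omega>))"
        using wg[OF u(1)] wg[OF U_grad] by simp
      also have "\<dots> = - (\<integral>x. (G x $ i + V x $ i) * \<eta> x * flat 1 ((f j x - 0) / 1) \<partial>M\<^sub>\<Omega>)"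
        by (subst Bochner_Integration.integral_add[symmetric, OF flat_int flat_int])
           (auto simp: algebra_simps intG)
      finally show ?thesis .
    qed
    have lim1: "(\<lambda>j. \<integral>x. (u x + U x) * D j x \<partial>M\<^sub>\<Omega>) \<longlonglongrightarrow> (\<integral>x. (u x + U x) * D0 x \<partial>M\<^sub>\<Omega>)"
    proof (rule integral_dominated_convergence[where w = "\<lambda>x. 2 * C * w x"])
      show "AE x in M\<^sub>\<Omega>. (\<lambda>j. (u x + U x) * D j x) \<longlonglongrightarrow> (u x + U x) * D0 x"
        using approx
      proof eventually_elim
        case (elim x)
        show ?case unfolding D_def D0_def
          using elim tendsto_flat_compose[of "\<lambda>i. f i x" "U x" _ 0 1]
          by (auto intro!: tendsto_intros)
      qed
      show "AE x in M\<^sub>\<Omega>. norm ((u x + U x) * D j x) \<le> 2 * C * w x" for j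
        using C UC D_le
      proof eventually_elim
        case (elim x)
        have "\<bar>u x + U x\<bar> * \<bar>D j x\<bar> \<le> (2 * C) * w x" using elim by (intro mult_mono) auto
        then show ?case by (simp add: abs_mult)
      qed
    qed (use w_int in auto)
    \<comment> \<open>On the set U = 0 it is \<open>D0\<close> that vanishes, since both profiles in
      it are zero there.\<close>
    have "(\<lambda>x. (u x + U x) * D0 x) = (\<lambda>x. 0)"
      by (auto simp: fun_eq_iff U_eq neg_part_def D0_def max_def)
    then have lim1': "(\<lambda>j. - (\<integral>x. (G x $ i + V x $ i) * \<eta> x * flat 1 ((f j x - 0) / 1) \<partial>M\<^sub>\<Omega>)) \<longlonglongrightarrow> 0"
      using lim1 unfolding ident by (simp only: integral_zero)
    have lim2: "(\<lambda>j. \<integral>x. (G x $ i + V x $ i) * \<eta> x * flat 1 ((f j x - 0) / 1) \<partial>M\<^sub>\<Omega>) \<longlonglongrightarrow>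
        (\<integral>x. (G x $ i + V x $ i) * \<eta> x * flat 1 ((U x - 0) / 1) \<partial>M\<^sub>\<Omega>)"
    proof (rule integral_flat_tendsto)
      show "integrable M\<^sub>\<Omega> (\<lambda>x. (G x $ i + V x $ i) * \<eta> x)"
        by (rule integrable_mult_bounded[OF GV _ B\<eta>(1)]) measurable
    qed
    have "(\<integral>x. (G x $ i + V x $ i) * \<eta> x * flat 1 ((U x - 0) / 1) \<partial>M\<^sub>\<Omega>) = 0"
      using LIMSEQ_unique[OF tendsto_minus[OF lim2] lim1'] by simp
    then show "(\<integral>x. (G x $ i + V x $ i) * flat 1 (U x) * \<eta> x \<partial>M\<^sub>\<Omega>) = 0"
      by (simp add: mult.assoc mult.commute[of "\<eta> _"])
  qed
  then have "AE x in M\<^sub>\<Omega>. \<forall>i\<in>UNIV. (G x $ i + V x $ i) * flat 1 (U x) = 0"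
    by (intro AE_finite_allI) auto
  then show ?thesis
  proof eventually_elim
    case (elim x)
    show ?case
    proof
      assume "U x > 0"
      then have "flat 1 (U x) \<noteq> 0" using flat_1_bounds(3) by fastforce
      then show "G x = - V x" using elim by (auto simp: vec_eq_iff eq_neg_iff_add_eq_0)
    qed
  qed
qed

end

section \<open>Level sets of supersolutions\<close>

text \<open>With r = 1/t the claim is (1 + r)^2 \<le> 2 exp r, which holds because (1 + r)^2 \<le> 2
  (1 + r + r^2/2). It is the coupling (\<Phi>')^2 \<le> 2 \<psi> between the truncation and the
  weight of the energy.\<close>

lemma flat_one_plus_square_le: "(flat [:1, 1:] t)\<^sup>2 \<le> 2 * flat 1 t"
proof (cases "t > 0")
  case True
  define r where "r = 1 / t"
  have r: "r \<ge> 0" using True by (simp add: r_def)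
  have "(1 + r)\<^sup>2 \<le> 2 * exp r"
    using exp_lower_Taylor_quadratic[OF r] by (simp add: power2_eq_square algebra_simps)
  then have "(1 + r)\<^sup>2 * (exp (- r))\<^sup>2 \<le> 2 * exp r * (exp (- r))\<^sup>2" by (intro mult_right_mono) auto
  also have "\<dots> = 2 * exp (- r)" by (simp add: power2_eq_square exp_minus)
  finally show ?thesis using True by (simp add: flat_def r_def power_mult_distrib)
qed simp

lemma times_flat_nonneg: "0 \<le> t * flat 1 t"
  by (simp add: flat_def)

text \<open>The function t exp(-1/t) is the smooth substitute for the positive part; its derivative
  (1 + 1/t) exp(-1/t) is the flat function of the polynomial 1 + r.\<close>

lemma DERIV_times_flat: "((\<lambda>t. t * flat 1 t) has_real_derivative flat [:1, 1:] t) (at t)"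
proof -
  have "((\<lambda>t. t * flat 1 t) has_real_derivative t * flat (flat_deriv 1) t + flat 1 t) (at t)"
    by (auto intro!: derivative_eq_intros DERIV_flat)
  moreover have "t * flat (flat_deriv 1) t + flat 1 t = flat [:1, 1:] t"
    by (auto simp: flat_def flat_deriv_def field_simps)
  ultimately show ?thesis by simp
qed

text \<open>The iteration uses the levels \<open>d (1 - 2\<^sup>-\<^sup>j)\<close>, along which \<open>\<phi>\<close> decays like \<open>4\<^sup>-\<^sup>j\<^sup>/\<^sup>\<gamma>\<close>.\<close>

lemma level_set_iteration:
  fixes \<phi> :: "real \<Rightarrow> real"
  assumes \<phi>: "\<And>k. 0 \<le> \<phi> k" "\<And>h k. k \<le> h \<Longrightarrow> \<phi> h \<le> \<phi> k"
    and decay: "\<And>h k. 0 \<le> k \<Longrightarrow> k < h \<Longrightarrow> (h - k)\<^sup>2 * \<phi> h \<le> K * \<phi> k powr (1 + \<gamma>)"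
    and \<gamma>: "\<gamma> > 0" and K: "K \<ge> 0" and a: "\<phi> 0 \<le> a"
    and d: "d > 0" "4 * K * a powr \<gamma> * 4 powr (1 / \<gamma>) \<le> d\<^sup>2"
  shows "\<phi> d = 0"
proof -
  define q :: real where "q = 4 powr (- (1 / \<gamma>))"
  have q: "0 < q" "q < 1"
    using \<gamma> by (auto simp: q_def powr_less_one)
  \<comment> \<open>The ratio \<open>q\<close> is chosen so that its power \<gamma> offsets the
    factor 1/4 by which the squared gap between consecutive levels shrinks.\<close>
  have "q powr \<gamma> = 4 powr (- 1)" using \<gamma> by (simp add: q_def powr_powr)
  then have q\<gamma>: "q powr \<gamma> = 1 / 4" by simp
  have a0: "0 \<le> a" using \<phi>(1)[of 0] a by linarith
  have level: "\<phi> (d * (1 - (1/2)^j)) \<le> a * q ^ j" for j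
  proof (induction j)
    case (Suc j)
    let ?k = "d * (1 - (1/2)^j)" and ?h = "d * (1 - (1/2)^Suc j)"
    have diff: "?h - ?k = d * (1/2)^Suc j" by (simp add: algebra_simps)
    have kh: "0 \<le> ?k" "?k < ?h"
      using d(1) by (auto simp: power_le_one)
    have "(d * (1/2)^Suc j)\<^sup>2 * \<phi> ?h \<le> K * \<phi> ?k powr (1 + \<gamma>)"
      using decay[OF kh] unfolding diff .
    also have "\<dots> \<le> K * (a * q ^ j) powr (1 + \<gamma>)"
      using Suc \<phi>(1) \<gamma> K by (intro mult_left_mono powr_mono2) auto
    also have "(a * q ^ j) powr (1 + \<gamma>) = a * q ^ j * (a powr \<gamma> * (1/4) ^ j)"
    proof -
      have "(q ^ j) powr \<gamma> = (1/4) ^ j"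
        using q(1) by (induction j) (auto simp: powr_mult q\<gamma>)
      then show ?thesis using a0 q by (cases "a = 0") (auto simp: powr_add powr_mult)
    qed
    \<comment> \<open>Passing from j to j + 1 costs a factor 4 from the gap and a factor 1/q from
      the claimed decay; these account for the two factors in the condition on
      \<open>d\<close>.\<close>
    also have "K * (a * q ^ j * (a powr \<gamma> * (1/4) ^ j)) = (4 * K * a powr \<gamma> * (1 / q)) * ((1/4)^Suc j * (a * q ^ Suc j))"
      using q(1) by (simp add: field_simps)
    also have "1 / q = 4 powr (1 / \<gamma>)" by (simp add: q_def powr_minus_divide)
    also have "(4 * K * a powr \<gamma> * 4 powr (1 / \<gamma>)) * ((1/4)^Suc j * (a * q ^ Suc j)) \<le> d\<^sup>2 * ((1/4)^Suc j * (a * q ^ Suc j))"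
      using d(2) a0 q by (intro mult_right_mono) auto
    also have "\<dots> = (d * (1/2)^Suc j)\<^sup>2 * (a * q ^ Suc j)"
    proof -
      have "((1/2)^Suc j)\<^sup>2 = (1/4 :: real)^Suc j"
        unfolding power2_eq_square power_mult_distrib[symmetric] by simp
      then show ?thesis by (simp only: power_mult_distrib mult.assoc)
    qed
    finally show ?case
      using d(1) by (auto simp: mult_le_cancel_left_pos)
  qed (use a in simp)
  have "\<phi> d \<le> a * q ^ j" for j
    using level[of j] \<phi>(2)[of "d * (1 - (1/2)^j)" d] d(1) by (auto simp: algebra_simps intro: order_trans)
  moreover have "(\<lambda>j. a * q ^ j) \<longlonglongrightarrow> a * 0"
    using q by (intro tendsto_intros LIMSEQ_power_zero) auto
  ultimately have "\<phi> d \<le> 0" by (intro LIMSEQ_le_const) auto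
  then show ?thesis using \<phi>(1)[of d] by linarith
qed

section \<open>Superlevel sets and the weighted energy\<close>

context dominated_approximation
begin

definition superlevel :: "real \<Rightarrow> (real^'n) set" where
  "superlevel k = {x \<in> \<Omega>. k < U x}"

lemma superlevel_sets [measurable]: "superlevel k \<in> sets M\<^sub>\<Omega>"
proof -
  have "superlevel k = {x \<in> space M\<^sub>\<Omega>. k < U x}" by (simp add: superlevel_def)
  also have "\<dots> \<in> sets M\<^sub>\<Omega>" by measurable
  finally show ?thesis .
qed

lemma superlevel_Int [simp]: "superlevel k \<inter> \<Omega> = superlevel k"
  by (auto simp: superlevel_def)

lemma superlevel_antimono: "k \<le> h \<Longrightarrow> measure M\<^sub>\<Omega> (superlevel h) \<le> measure M\<^sub>\<Omega> (superlevel k)"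
  by (intro finite_measure_mono superlevel_sets) (auto simp: superlevel_def)

lemma superlevel_flat: "s > 0 \<Longrightarrow> x \<in> \<Omega> \<Longrightarrow> x \<notin> superlevel k \<Longrightarrow> flat p ((U x - k) / s) = 0"
  by (simp add: superlevel_def divide_nonpos_pos)

text \<open>The cube average inequality holds for the truncated approximants and passes to the limit
  by dominated convergence. The L1 term is kept here; it is absorbed once the side \<open>l\<close>
  is fixed.\<close>

lemma truncation_inequality:
  fixes k s l :: real
  assumes k: "k \<ge> 0" and s: "s > 0" and l: "l \<ge> 0"
  defines "w \<equiv> \<lambda>x. s * ((U x - k) / s * flat 1 ((U x - k) / s))"
  shows "integrable M\<^sub>\<Omega> (\<lambda>x. (w x)\<^sup>2)" "integrable M\<^sub>\<Omega> w"
    "integrable M\<^sub>\<Omega> (\<lambda>x. (flat [:1, 1:] ((U x - k) / s) * norm (V x))\<^sup>2)"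
    "l ^ CARD('n) * (\<integral>x. (w x)\<^sup>2 \<partial>M\<^sub>\<Omega>) \<le>
       l ^ CARD('n) * (CARD('n) * l\<^sup>2) * (\<integral>x. (flat [:1, 1:] ((U x - k) / s) * norm (V x))\<^sup>2 \<partial>M\<^sub>\<Omega>)
       + 2 * (\<integral>x. w x \<partial>M\<^sub>\<Omega>)\<^sup>2"
proof -
  \<comment> \<open>The prefactor \<open>s\<close> cancels the 1/s of the chain rule, so the
    derivative is bounded independently of the gap.\<close>
  define \<Psi> where "\<Psi> t = s * ((t - k) / s * flat 1 ((t - k) / s))" for t
  have w: "w = (\<lambda>x. \<Psi> (U x))" by (simp add: w_def \<Psi>_def)
  obtain B where B: "B \<ge> 0" "\<And>t. \<bar>flat [:1, 1:] t\<bar> \<le> B" using bounded_flat by metis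
  have \<Psi>_bounds: "0 \<le> \<Psi> t" "\<Psi> t \<le> \<bar>t\<bar>" for t
  proof -
    show "0 \<le> \<Psi> t"
      unfolding \<Psi>_def using s by (intro mult_nonneg_nonneg times_flat_nonneg) auto
    show "\<Psi> t \<le> \<bar>t\<bar>"
    proof (cases "(t - k) / s > 0")
      case True
      then have "t > k" using s by (simp add: zero_less_divide_iff)
      have "\<Psi> t = (t - k) * flat 1 ((t - k) / s)" using s by (simp add: \<Psi>_def)
      also have "\<dots> \<le> t - k" using \<open>t > k\<close> flat_1_bounds by (intro mult_left_le) auto
      finally show ?thesis using k by linarith
    qed (auto simp: \<Psi>_def)
  qed
  \<comment> \<open>Here k \<ge> 0 enters: the truncated approximants vanish off \<Omega>, so that
    the inequality on the whole space applies to them.\<close>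
  have \<Psi>0: "\<Psi> 0 = 0" using k s by (simp add: \<Psi>_def divide_nonpos_pos)
  have \<Psi>_deriv: "(\<Psi> has_real_derivative flat [:1, 1:] ((t - k) / s)) (at t)" for t
  proof -
    have "((\<lambda>t. (t - k) / s) has_real_derivative 1 / s) (at t)"
      using s by (auto intro!: derivative_eq_intros)
    from DERIV_cmult[OF DERIV_chain2[OF DERIV_times_flat this], of s]
    show ?thesis using s by (simp add: \<Psi>_def[abs_def])
  qed
  have \<Psi>_cont: "continuous_on UNIV \<Psi>"
    using \<Psi>_deriv by (meson DERIV_isCont continuous_at_imp_continuous_on)
  then have [measurable]: "\<Psi> \<in> borel_measurable borel" by (rule borel_measurable_continuous_onI)
  have \<Psi>_lim: "(\<lambda>i. \<Psi> (a i)) \<longlonglongrightarrow> \<Psi> b" if "a \<longlonglongrightarrow> b" for a b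
    by (rule continuous_on_tendsto_compose[OF \<Psi>_cont that]) auto
  define F where "F i x = \<Psi> (f i x)" for i x
  define P where "P i x = flat [:1, 1:] ((f i x - k) / s) *\<^sub>R g i x" for i x
  have F_grad: "(F i has_derivative (\<lambda>v. P i x \<bullet> v)) (at x)" for i x
    using has_derivative_compose[OF grad \<Psi>_deriv[unfolded has_field_derivative_def]]
    by (simp add: F_def[abs_def] P_def)
  have F_cont: "continuous_on UNIV (F i)" for i
    using F_grad by (meson continuous_at_imp_continuous_on has_derivative_continuous)
  have P_cont: "continuous_on UNIV (P i)" for i
    unfolding P_def using test_fun_continuous[OF test] test_fun_gradient_continuous[OF test grad] s
    by (intro continuous_intros continuous_on_compose2[OF continuous_flat]) (use s in auto)
  have [measurable]: "F i \<in> borel_measurable M\<^sub>\<Omega>" "P i \<in> borel_measurable M\<^sub>\<Omega>" for i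
    using borel_measurable_lebesgue_on_continuous F_cont P_cont by auto
  have F_nonneg: "0 \<le> F i x" for i x by (simp add: F_def \<Psi>_bounds)
  have F_out: "F i x = 0" if "x \<notin> \<Omega>" for i x
    using test_fun_eq_0[OF test that] by (simp add: F_def \<Psi>0)
  have P_out: "P i x = 0" if "x \<notin> \<Omega>" for i x
  proof -
    have "x \<notin> closure {x. f i x \<noteq> 0}" using test[of i] that by (auto simp: test_fun_def)
    then show ?thesis using gradient_eq_0_outside_support[OF grad] by (simp add: P_def)
  qed
  have ineq: "l ^ CARD('n) * (\<integral>x. (F i x)\<^sup>2 \<partial>M\<^sub>\<Omega>) \<le>
       l ^ CARD('n) * (CARD('n) * l\<^sup>2) * (\<integral>x. (norm (P i x))\<^sup>2 \<partial>M\<^sub>\<Omega>) + 2 * (\<integral>x. F i x \<partial>M\<^sub>\<Omega>)\<^sup>2" for i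
  proof -
    obtain Bf where Bf: "\<And>x. \<bar>f i x\<bar> \<le> Bf" "Bf \<ge> 0" using test_fun_bounded[OF test] by metis
    obtain Bg where Bg: "\<And>x. norm (g i x) \<le> Bg" "Bg \<ge> 0" using test_fun_gradient_bounded[OF test grad] by metis
    have F_le: "F i x \<le> Bf" for x using \<Psi>_bounds(2)[of "f i x"] Bf(1)[of x] by (simp add: F_def)
    have P_le: "norm (P i x) \<le> B * Bg" for x
      unfolding P_def norm_scaleR real_norm_def using B Bg by (intro mult_mono) auto
    have 1: "(\<integral>\<^sup>+x. ennreal ((F i x)\<^sup>2) \<partial>lborel) = ennreal (\<integral>x. (F i x)\<^sup>2 \<partial>M\<^sub>\<Omega>)"
      by (rule nn_integral_lborel_eq_integral_lebesgue_on[OF open_\<Omega> bounded_\<Omega>, where B = "Bf\<^sup>2"])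
         (auto intro!: continuous_intros F_cont power_mono F_nonneg F_le simp: F_out)
    have 2: "(\<integral>\<^sup>+x. ennreal ((norm (P i x))\<^sup>2) \<partial>lborel) = ennreal (\<integral>x. (norm (P i x))\<^sup>2 \<partial>M\<^sub>\<Omega>)"
      by (rule nn_integral_lborel_eq_integral_lebesgue_on[OF open_\<Omega> bounded_\<Omega>, where B = "(B * Bg)\<^sup>2"])
         (auto intro!: continuous_intros P_cont power_mono P_le simp: P_out)
    have 3: "(\<integral>\<^sup>+x. ennreal \<bar>F i x\<bar> \<partial>lborel) = ennreal (\<integral>x. F i x \<partial>M\<^sub>\<Omega>)"
      using nn_integral_lborel_eq_integral_lebesgue_on[OF open_\<Omega> bounded_\<Omega> F_cont F_nonneg F_le F_out]
      by (simp add: F_nonneg)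
    have nonneg: "0 \<le> (\<integral>x. (F i x)\<^sup>2 \<partial>M\<^sub>\<Omega>)" "0 \<le> (\<integral>x. (norm (P i x))\<^sup>2 \<partial>M\<^sub>\<Omega>)" "0 \<le> (\<integral>x. F i x \<partial>M\<^sub>\<Omega>)"
      by (auto intro!: integral_nonneg_AE simp: F_nonneg)
    have "ennreal (l ^ CARD('n) * (\<integral>x. (F i x)\<^sup>2 \<partial>M\<^sub>\<Omega>)) \<le>
       ennreal (l ^ CARD('n) * (CARD('n) * l\<^sup>2) * (\<integral>x. (norm (P i x))\<^sup>2 \<partial>M\<^sub>\<Omega>) + 2 * (\<integral>x. F i x \<partial>M\<^sub>\<Omega>)\<^sup>2)"
      using nn_integral_square_le_cube_average[OF F_grad P_cont l, of i] nonneg l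
      unfolding 1 2 3 by (simp add: ennreal_mult ennreal_plus flip: ennreal_power)
    then show ?thesis using nonneg l by (subst (asm) ennreal_le_iff) auto
  qed
  have F_sq: "AE x in M\<^sub>\<Omega>. \<forall>i. (F i x)\<^sup>2 \<le> H x"
    using approx
  proof eventually_elim
    case (elim x)
    have "(F i x)\<^sup>2 \<le> (f i x)\<^sup>2" for i
      using power_mono[OF \<Psi>_bounds(2,1), of "f i x" 2] by (simp add: F_def)
    then show ?case using elim by (meson order_trans)
  qed
  have dom1: "(\<lambda>i. (F i x)\<^sup>2) \<longlonglongrightarrow> (w x)\<^sup>2" "(\<lambda>i. F i x) \<longlonglongrightarrow> w x"
    "(\<lambda>i. (norm (P i x))\<^sup>2) \<longlonglongrightarrow> (flat [:1, 1:] ((U x - k) / s) * norm (V x))\<^sup>2"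
    if "(\<lambda>i. f i x) \<longlonglongrightarrow> U x" "(\<lambda>i. g i x) \<longlonglongrightarrow> V x" for x
    using that unfolding F_def w P_def norm_scaleR power_mult_distrib real_norm_def power2_abs
    by (auto intro!: tendsto_intros \<Psi>_lim tendsto_flat_compose)
  have F2: "AE x in M\<^sub>\<Omega>. (\<lambda>i. (F i x)\<^sup>2) \<longlonglongrightarrow> (w x)\<^sup>2"
    using approx by eventually_elim (use dom1 in blast)
  have F1: "AE x in M\<^sub>\<Omega>. (\<lambda>i. F i x) \<longlonglongrightarrow> w x"
    using approx by eventually_elim (use dom1 in blast)
  have P2: "AE x in M\<^sub>\<Omega>. (\<lambda>i. (norm (P i x))\<^sup>2) \<longlonglongrightarrow> (flat [:1, 1:] ((U x - k) / s) * norm (V x))\<^sup>2"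
    using approx by eventually_elim (use dom1 in blast)
  have F2b: "AE x in M\<^sub>\<Omega>. norm ((F i x)\<^sup>2) \<le> H x" for i
    using F_sq by eventually_elim auto
  have F1b: "AE x in M\<^sub>\<Omega>. norm (F i x) \<le> 1 + H x" for i
    using F_sq
  proof eventually_elim
    case (elim x)
    have "\<bar>F i x\<bar> \<le> 1 + (F i x)\<^sup>2"
      using zero_le_power2[of "F i x - 1"] F_nonneg[of i x] by (simp add: power2_eq_square algebra_simps)
    then show ?case using elim by (smt (verit) real_norm_def)
  qed
  have P2b: "AE x in M\<^sub>\<Omega>. norm ((norm (P i x))\<^sup>2) \<le> B\<^sup>2 * H x" for i
    using approx
  proof eventually_elim
    case (elim x)
    have "(flat [:1, 1:] ((f i x - k) / s))\<^sup>2 * (norm (g i x))\<^sup>2 \<le> B\<^sup>2 * H x"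
      using elim B power_mono[OF B(2)[of "(f i x - k) / s"], of 2] by (intro mult_mono) auto
    then show ?case by (simp add: P_def power_mult_distrib)
  qed
  have wm [measurable]: "w \<in> borel_measurable M\<^sub>\<Omega>" unfolding w by measurable
  have H': "integrable M\<^sub>\<Omega> (\<lambda>x. 1 + H x)" "integrable M\<^sub>\<Omega> (\<lambda>x. B\<^sup>2 * H x)" using H by auto
  note dct = integral_dominated_convergence integrable_dominated_convergence
  show "integrable M\<^sub>\<Omega> (\<lambda>x. (w x)\<^sup>2)"
    by (rule dct(2)[OF _ _ H F2 F2b]) auto
  show "integrable M\<^sub>\<Omega> w"
    by (rule dct(2)[OF _ _ H'(1) F1 F1b]) auto
  show "integrable M\<^sub>\<Omega> (\<lambda>x. (flat [:1, 1:] ((U x - k) / s) * norm (V x))\<^sup>2)"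
    by (rule dct(2)[OF _ _ H'(2) P2 P2b]) auto
  have l2: "(\<lambda>i. \<integral>x. (F i x)\<^sup>2 \<partial>M\<^sub>\<Omega>) \<longlonglongrightarrow> (\<integral>x. (w x)\<^sup>2 \<partial>M\<^sub>\<Omega>)"
    by (rule dct(1)[OF _ _ H F2 F2b]) auto
  have l1: "(\<lambda>i. \<integral>x. F i x \<partial>M\<^sub>\<Omega>) \<longlonglongrightarrow> (\<integral>x. w x \<partial>M\<^sub>\<Omega>)"
    by (rule dct(1)[OF _ _ H'(1) F1 F1b]) auto
  have lP: "(\<lambda>i. \<integral>x. (norm (P i x))\<^sup>2 \<partial>M\<^sub>\<Omega>) \<longlonglongrightarrow> (\<integral>x. (flat [:1, 1:] ((U x - k) / s) * norm (V x))\<^sup>2 \<partial>M\<^sub>\<Omega>)"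
    by (rule dct(1)[OF _ _ H'(2) P2 P2b]) auto
  show "l ^ CARD('n) * (\<integral>x. (w x)\<^sup>2 \<partial>M\<^sub>\<Omega>) \<le>
       l ^ CARD('n) * (CARD('n) * l\<^sup>2) * (\<integral>x. (flat [:1, 1:] ((U x - k) / s) * norm (V x))\<^sup>2 \<partial>M\<^sub>\<Omega>)
       + 2 * (\<integral>x. w x \<partial>M\<^sub>\<Omega>)\<^sup>2"
    by (rule LIMSEQ_le[OF tendsto_mult[OF tendsto_const l2]
          tendsto_add[OF tendsto_mult[OF tendsto_const lP] tendsto_mult[OF tendsto_const tendsto_power[OF l1]]]])
       (use ineq in auto)
qed

text \<open>In the constant, one factor 2 comes from absorbing the L1 term, the other from
  (\<Phi>')^2 \<le> 2 \<psi>, and exp 2 from the lower bound (h - k)/e for the truncation where U >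
  h. The power of 4 a is the squared side of the cube of volume 4 a.\<close>

lemma level_set_estimate:
  assumes k: "0 \<le> k" "k < h"
  defines "a \<equiv> measure M\<^sub>\<Omega> (superlevel k)"
  shows "(h - k)\<^sup>2 * measure M\<^sub>\<Omega> (superlevel h) \<le>
    4 * exp 2 * CARD('n) * (4 * a) powr (2 / CARD('n)) *
    (\<integral>x. flat 1 ((U x - k) / (h - k)) * (norm (V x))\<^sup>2 \<partial>M\<^sub>\<Omega>)"
proof (cases "a = 0")
  case True
  then have "measure M\<^sub>\<Omega> (superlevel h) = 0"
    using superlevel_antimono[of k h] k measure_nonneg[of M\<^sub>\<Omega> "superlevel h"] unfolding a_def by linarith
  then show ?thesis using True by simp
next
  case False
  then have a: "a > 0" using measure_nonneg[of M\<^sub>\<Omega> "superlevel k"] unfolding a_def by linarith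
  define s where "s = h - k"
  have s: "s > 0" using k by (simp add: s_def)
  let ?n = "real CARD('n)"
  define l where "l = (4 * a) powr (1 / ?n)"
  have l: "l > 0" "l ^ CARD('n) = 4 * a" "l\<^sup>2 = (4 * a) powr (2 / ?n)"
    using a by (auto simp: l_def powr_powr simp flip: powr_realpow)
  define w where "w x = s * ((U x - k) / s * flat 1 ((U x - k) / s))" for x
  define D where "D = (\<integral>x. (flat [:1, 1:] ((U x - k) / s) * norm (V x))\<^sup>2 \<partial>M\<^sub>\<Omega>)"
  have l0: "l \<ge> 0" using l(1) by simp
  note trunc = truncation_inequality[OF k(1) s l0, folded w_def]
  define I where "I = (\<integral>x. w x \<partial>M\<^sub>\<Omega>)"
  have ind: "integrable M\<^sub>\<Omega> (\<lambda>x. indicator (superlevel k) x :: real)"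
    by (intro integrable_real_indicator) (auto simp: emeasure_eq_measure)
  have w_out: "w x = 0" if "x \<in> \<Omega>" "x \<notin> superlevel k" for x
    using superlevel_flat[OF s that] by (simp add: w_def)
  \<comment> \<open>Cauchy-Schwarz on the support of \<open>w\<close>, obtained by integrating (w -
    I/a)^2 over the superlevel set.\<close>
  have "I\<^sup>2 \<le> a * (\<integral>x. (w x)\<^sup>2 \<partial>M\<^sub>\<Omega>)"
  proof -
    have "0 \<le> (\<integral>x. (w x)\<^sup>2 - 2 * (I / a) * w x + (I / a)\<^sup>2 * indicator (superlevel k) x \<partial>M\<^sub>\<Omega>)"
    proof (rule integral_nonneg_AE, rule AE_I2)
      fix x assume "x \<in> space M\<^sub>\<Omega>"
      then show "0 \<le> (w x)\<^sup>2 - 2 * (I / a) * w x + (I / a)\<^sup>2 * indicator (superlevel k) x"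
        using zero_le_power2[of "w x - I / a"] w_out[of x]
        by (cases "x \<in> superlevel k") (auto simp: power2_diff algebra_simps)
    qed
    also have "\<dots> = (\<integral>x. (w x)\<^sup>2 \<partial>M\<^sub>\<Omega>) - 2 * (I / a) * I + (I / a)\<^sup>2 * a"
      using trunc(1,2) ind by (simp add: I_def a_def)
    also have "\<dots> = (\<integral>x. (w x)\<^sup>2 \<partial>M\<^sub>\<Omega>) - I\<^sup>2 / a"
      using a by (simp add: power2_eq_square)
    finally show ?thesis using a by (simp add: field_simps)
  qed
  \<comment> \<open>Since the cube has volume 4 a, the left side is 4 a times the integral of w^2,
    of which the L1 term takes at most half.\<close>
  with trunc(4) have "2 * (\<integral>x. (w x)\<^sup>2 \<partial>M\<^sub>\<Omega>) * a \<le> (4 * (?n * l\<^sup>2) * D) * a"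
    unfolding l(2) D_def[symmetric] I_def[symmetric] by (simp add: algebra_simps)
  then have *: "(\<integral>x. (w x)\<^sup>2 \<partial>M\<^sub>\<Omega>) \<le> 2 * (?n * l\<^sup>2) * D"
    using a by (simp add: mult_le_cancel_right mult_ac)
  have fV: "integrable M\<^sub>\<Omega> (\<lambda>x. flat 1 ((U x - k) / s) * (norm (V x))\<^sup>2)"
    using integrable_mult_bounded[OF UV(4), of "\<lambda>x. flat 1 ((U x - k) / s)" 1] flat_1_bounds
    by (simp add: mult.commute)
  have "D \<le> (\<integral>x. 2 * (flat 1 ((U x - k) / s) * (norm (V x))\<^sup>2) \<partial>M\<^sub>\<Omega>)"
    unfolding D_def using trunc(3) fV
  proof (intro integral_mono)
    fix x show "(flat [:1, 1:] ((U x - k) / s) * norm (V x))\<^sup>2 \<le> 2 * (flat 1 ((U x - k) / s) * (norm (V x))\<^sup>2)"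
      using mult_right_mono[OF flat_one_plus_square_le, of "(norm (V x))\<^sup>2" "(U x - k) / s"]
      by (simp add: power_mult_distrib mult.assoc)
  qed auto
  then have D: "D \<le> 2 * (\<integral>x. flat 1 ((U x - k) / s) * (norm (V x))\<^sup>2 \<partial>M\<^sub>\<Omega>)" by simp
  have "s\<^sup>2 * exp (- 2) * measure M\<^sub>\<Omega> (superlevel h) = (\<integral>x. s\<^sup>2 * exp (- 2) * indicator (superlevel h) x \<partial>M\<^sub>\<Omega>)"
    by simp
  also have "\<dots> \<le> (\<integral>x. (w x)\<^sup>2 \<partial>M\<^sub>\<Omega>)"
  proof (rule integral_mono)
    fix x
    show "s\<^sup>2 * exp (- 2) * indicator (superlevel h) x \<le> (w x)\<^sup>2"
    proof (cases "x \<in> superlevel h")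
      case True
      \<comment> \<open>Above level h the normalised variable is at least 1, where t exp(-1/t) is at
        least 1/e.\<close>
      define t where "t = (U x - k) / s"
      have t: "t \<ge> 1" using True s by (simp add: t_def superlevel_def s_def)
      then have "exp (- 1) \<le> flat 1 t" by (simp add: flat_def)
      then have "1 * exp (- 1) \<le> t * flat 1 t" using t by (intro mult_mono) auto
      then have "s * (1 * exp (- 1)) \<le> s * (t * flat 1 t)" using s by (intro mult_left_mono) auto
      then have "s * exp (- 1) \<le> w x" by (simp only: w_def t_def mult_1)
      then have "(s * exp (- 1))\<^sup>2 \<le> (w x)\<^sup>2" using s by (intro power_mono) auto
      then show ?thesis using True by (simp add: power_mult_distrib flip: exp_of_nat_mult)
    qed simp
  qed (use trunc(1) in \<open>auto intro!: integrable_mult_right integrable_real_indicator simp: emeasure_eq_measure\<close>)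
  also have "\<dots> \<le> 2 * (?n * l\<^sup>2) * (2 * (\<integral>x. flat 1 ((U x - k) / s) * (norm (V x))\<^sup>2 \<partial>M\<^sub>\<Omega>))"
    by (rule order_trans[OF * mult_left_mono[OF D]]) simp
  finally have "exp 2 * (s\<^sup>2 * exp (- 2) * measure M\<^sub>\<Omega> (superlevel h)) \<le>
      exp 2 * (2 * (?n * l\<^sup>2) * (2 * (\<integral>x. flat 1 ((U x - k) / s) * (norm (V x))\<^sup>2 \<partial>M\<^sub>\<Omega>)))"
    by (intro mult_left_mono) auto
  moreover have "exp 2 * (s\<^sup>2 * exp (- 2) * measure M\<^sub>\<Omega> (superlevel h)) =
      (exp 2 * exp (- 2)) * (s\<^sup>2 * measure M\<^sub>\<Omega> (superlevel h))" by (simp only: mult_ac)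
  moreover have "exp 2 * exp (- 2) = (1 :: real)" by (simp flip: exp_add)
  ultimately have "s\<^sup>2 * measure M\<^sub>\<Omega> (superlevel h) \<le>
      exp 2 * (2 * (?n * l\<^sup>2) * (2 * (\<integral>x. flat 1 ((U x - k) / s) * (norm (V x))\<^sup>2 \<partial>M\<^sub>\<Omega>)))"
    by (simp only: mult_1)
  then show ?thesis unfolding l(3) s_def by (simp only: mult_ac)
qed

text \<open>The energy estimate with weight \<psi>((U - k)/s). Its right side is linear in
  \<open>m\<close> because the zero order term is linear in \<open>u\<close>, and it depends on the
  ellipticity constants only through the product \<mu>1 \<theta>.\<close>

lemma caccioppoli:
  fixes k s lam :: real
  assumes coeffs: "standing_coeffs \<Omega> p A \<theta> M \<mu>1 \<mu>2 c h" and p: "p > 1" and lam: "lam \<in> {0..\<Lambda>}"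
    and \<Omega>: "\<Omega> \<noteq> {}"
    and u: "H1_grad \<Omega> u G" "Linf \<Omega> u" "\<And>x. U x = neg_part (u x)"
    and super: "\<And>\<phi> g. test_fun \<Omega> \<phi> \<Longrightarrow> (\<And>x. 0 \<le> \<phi> x) \<Longrightarrow>
          (\<And>x. (\<phi> has_derivative (\<lambda>v. g x \<bullet> v)) (at x)) \<Longrightarrow>
          (\<integral>x. (A x *v G x) \<bullet> g x \<partial>M\<^sub>\<Omega>) \<ge>
            (\<integral>x. c_lambda lam c x * u x * \<phi> x \<partial>M\<^sub>\<Omega>)
          + (\<integral>x. \<phi> x * ((M x *v G x) \<bullet> G x) \<partial>M\<^sub>\<Omega>)
          + (\<integral>x. h x * \<phi> x \<partial>M\<^sub>\<Omega>)"
    and m: "AE x in M\<^sub>\<Omega>. U x \<le> m" "m \<ge> 0" and k: "k \<ge> 0" and s: "s > 0"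
  shows "\<mu>1 * \<theta> * (\<integral>x. flat 1 ((U x - k) / s) * (norm (V x))\<^sup>2 \<partial>M\<^sub>\<Omega>) \<le>
    (\<Lambda> * m * Lp_norm \<Omega> p c + Lp_norm \<Omega> p (\<lambda>x. neg_part (h x))) * measure M\<^sub>\<Omega> (superlevel k) powr (1 - 1 / p)"
proof -
  note uG = H1_gradD[OF u(1)]
  have [measurable]: "u \<in> borel_measurable M\<^sub>\<Omega>" "G \<in> borel_measurable M\<^sub>\<Omega>" using uG by auto
  obtain C where C: "AE x in M\<^sub>\<Omega>. \<bar>u x\<bar> \<le> C" using u(2) by (auto simp: Linf_def)
  have \<theta>: "\<theta> > 0" and \<mu>1: "\<mu>1 > 0" and Lc: "Lp \<Omega> p c" and Lh: "Lp \<Omega> p h"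
    and A_cont: "\<And>i j. continuous_on (closure \<Omega>) (\<lambda>x. A x $ i $ j)"
    and A_low: "\<And>x \<xi>. x \<in> closure \<Omega> \<Longrightarrow> \<theta> * (norm \<xi>)\<^sup>2 \<le> \<xi> \<bullet> (A x *v \<xi>)"
    and A_up: "\<And>x \<xi>. x \<in> closure \<Omega> \<Longrightarrow> \<xi> \<bullet> (A x *v \<xi>) \<le> (1 / \<theta>) * (norm \<xi>)\<^sup>2"
    and M_meas: "\<And>i j. (\<lambda>x. M x $ i $ j) \<in> borel_measurable M\<^sub>\<Omega>"
    and M_low: "\<And>x \<xi>. x \<in> \<Omega> \<Longrightarrow> \<mu>1 * (norm \<xi>)\<^sup>2 \<le> \<xi> \<bullet> (M x *v \<xi>)"
    and M_up: "\<And>x \<xi>. x \<in> \<Omega> \<Longrightarrow> \<xi> \<bullet> (M x *v \<xi>) \<le> \<mu>2 * (norm \<xi>)\<^sup>2"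
    using coeffs unfolding standing_coeffs_def by auto
  note M_meas [measurable]
  have [measurable]: "c \<in> borel_measurable M\<^sub>\<Omega>" "h \<in> borel_measurable M\<^sub>\<Omega>" using Lc Lh by (auto simp: Lp_def)
  \<comment> \<open>The lower and upper ellipticity bounds at a unit vector give \<theta> \<le>
    1/\<theta>.\<close>
  have \<theta>1: "\<theta> \<le> 1"
  proof -
    obtain x where x: "x \<in> closure \<Omega>" using \<Omega> closure_subset by blast
    obtain \<xi> :: "real^'n" where \<xi>: "norm \<xi> = 1" using vector_choose_size[of 1] by auto
    have "\<theta> \<le> 1 / \<theta>" using A_low[OF x, of \<xi>] A_up[OF x, of \<xi>] by (simp add: \<xi>)
    then have "\<theta> * \<theta> \<le> 1" using \<theta> by (simp add: field_simps)
    then show ?thesis using \<theta> by (smt (verit) mult_le_cancel_left1)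
  qed
  have A_meas [measurable]: "(\<lambda>x. A x $ i $ j) \<in> borel_measurable M\<^sub>\<Omega>" for i j
    by (rule continuous_imp_measurable_on_sets_lebesgue[OF continuous_on_subset[OF A_cont closure_subset] \<Omega>_sets])
  have mv_meas: "(\<lambda>x. N x *v G x) \<in> borel_measurable M\<^sub>\<Omega>"
    if [measurable]: "\<And>i j. (\<lambda>x. N x $ i $ j) \<in> borel_measurable M\<^sub>\<Omega>" for N :: "real^'n \<Rightarrow> real^'n^'n"
  proof -
    have "(\<lambda>x. (N x *v G x) $ i) \<in> borel_measurable M\<^sub>\<Omega>" for i
      unfolding matrix_vector_mult_def by simp
    then show ?thesis
      by (subst borel_measurable_euclidean_space) (auto simp: Basis_vec_def inner_axis)
  qed
  note [measurable] = mv_meas[OF A_meas] mv_meas[OF M_meas]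
  have "compact (closure \<Omega>)" using bounded_\<Omega> by (simp add: compact_closure)
  then have "\<exists>b\<ge>0. \<forall>x\<in>closure \<Omega>. \<bar>A x $ i $ j\<bar> \<le> b" for i j
  proof -
    have "compact ((\<lambda>x. A x $ i $ j) ` closure \<Omega>)"
      using \<open>compact (closure \<Omega>)\<close> A_cont by (intro compact_continuous_image) auto
    then obtain b where "\<forall>x\<in>closure \<Omega>. \<bar>A x $ i $ j\<bar> \<le> b"
      by (force dest!: compact_imp_bounded simp: bounded_iff)
    then show ?thesis by (intro exI[of _ "max b 0"]) fastforce
  qed
  then obtain b where b: "\<And>i j. b i j \<ge> 0" "\<And>i j x. x \<in> closure \<Omega> \<Longrightarrow> \<bar>A x $ i $ j\<bar> \<le> b i j" by metis
  \<comment> \<open>This crude bound on \<open>A\<close> only serves to put A Du in L2 for the limit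
    passage and leaves no trace in the estimate; \<open>\<mu>2\<close> plays the same part for the
    quadratic term.\<close>
  define B where "B = (\<Sum>i\<in>UNIV. \<Sum>j\<in>UNIV. b i j)"
  have A_bound: "norm (A x *v v) \<le> B * norm v" if "x \<in> closure \<Omega>" for x v
  proof -
    have "norm (A x *v v) \<le> (\<Sum>i\<in>UNIV. \<bar>(A x *v v) $ i\<bar>)" by (rule norm_le_l1_cart)
    also have "\<dots> \<le> (\<Sum>i\<in>UNIV. \<Sum>j\<in>UNIV. b i j * norm v)"
      unfolding matrix_vector_mult_def vec_lambda_beta
      by (intro sum_mono order_trans[OF sum_abs])
         (auto simp: abs_mult intro!: sum_mono mult_mono b that component_le_norm_cart)
    finally show ?thesis by (simp add: B_def sum_distrib_right)
  qed
  have AG_int: "integrable M\<^sub>\<Omega> (\<lambda>x. (norm (A x *v G x))\<^sup>2)"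
  proof (rule Bochner_Integration.integrable_bound)
    show "integrable M\<^sub>\<Omega> (\<lambda>x. B\<^sup>2 * (norm (G x))\<^sup>2)" using uG by simp
    show "AE x in M\<^sub>\<Omega>. norm ((norm (A x *v G x))\<^sup>2) \<le> norm (B\<^sup>2 * (norm (G x))\<^sup>2)"
    proof (rule AE_I2)
      fix x assume "x \<in> space M\<^sub>\<Omega>"
      then have "x \<in> closure \<Omega>" using closure_subset by auto
      from power_mono[OF A_bound[OF this], of "G x" 2]
      show "norm ((norm (A x *v G x))\<^sup>2) \<le> norm (B\<^sup>2 * (norm (G x))\<^sup>2)" by (simp add: power_mult_distrib)
    qed
  qed measurable
  have MG_bounds: "\<mu>1 * (norm (G x))\<^sup>2 \<le> (M x *v G x) \<bullet> G x" "(M x *v G x) \<bullet> G x \<le> \<mu>2 * (norm (G x))\<^sup>2"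
    if "x \<in> \<Omega>" for x
    using M_low[OF that] M_up[OF that] by (auto simp: inner_commute)
  have MG_int: "integrable M\<^sub>\<Omega> (\<lambda>x. (M x *v G x) \<bullet> G x)"
  proof (rule Bochner_Integration.integrable_bound)
    show "integrable M\<^sub>\<Omega> (\<lambda>x. \<mu>2 * (norm (G x))\<^sup>2)" using uG by simp
    show "AE x in M\<^sub>\<Omega>. norm ((M x *v G x) \<bullet> G x) \<le> norm (\<mu>2 * (norm (G x))\<^sup>2)"
    proof (rule AE_I2)
      fix x assume "x \<in> space M\<^sub>\<Omega>"
      then have "0 \<le> \<mu>1 * (norm (G x))\<^sup>2" "x \<in> \<Omega>" using \<mu>1 by auto
      then show "norm ((M x *v G x) \<bullet> G x) \<le> norm (\<mu>2 * (norm (G x))\<^sup>2)"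
        using MG_bounds[of x] unfolding real_norm_def by linarith
    qed
  qed measurable
  have fin: "emeasure M\<^sub>\<Omega> S < \<infinity>" for S by (simp add: emeasure_eq_measure)
  have Lp_int: "integrable M\<^sub>\<Omega> f" if "Lp \<Omega> p f" for f
  proof -
    have f: "f \<in> borel_measurable M\<^sub>\<Omega>" "integrable M\<^sub>\<Omega> (\<lambda>x. \<bar>f x\<bar> powr p)" using that by (auto simp: Lp_def)
    show ?thesis
      by (rule Bochner_Integration.integrable_bound[OF Holder_on_subset(1)[OF p f sets.top fin] f(1)]) auto
  qed
  have Lh': "Lp \<Omega> p (\<lambda>x. neg_part (h x))"
    unfolding Lp_def
  proof
    show neg_meas: "(\<lambda>x. neg_part (h x)) \<in> borel_measurable M\<^sub>\<Omega>" unfolding neg_part_def by measurable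
    show "integrable M\<^sub>\<Omega> (\<lambda>x. \<bar>neg_part (h x)\<bar> powr p)"
    proof (rule Bochner_Integration.integrable_bound)
      show "integrable M\<^sub>\<Omega> (\<lambda>x. \<bar>h x\<bar> powr p)" using Lh by (simp add: Lp_def)
      show "AE x in M\<^sub>\<Omega>. norm (\<bar>neg_part (h x)\<bar> powr p) \<le> norm (\<bar>h x\<bar> powr p)"
        using p by (intro AE_I2) (auto simp: neg_part_def intro!: powr_mono2)
    qed (use neg_meas in measurable)
  qed
  have Lp_D: "f \<in> borel_measurable M\<^sub>\<Omega>" "integrable M\<^sub>\<Omega> (\<lambda>x. \<bar>f x\<bar> powr p)" if "Lp \<Omega> p f" for f
    using that by (auto simp: Lp_def)
  note c_Holder = Holder_on_subset[OF p Lp_D[OF Lc] superlevel_sets fin]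
  note h_Holder = Holder_on_subset[OF p Lp_D[OF Lh'] superlevel_sets fin]
  have cu_int: "integrable M\<^sub>\<Omega> (\<lambda>x. c_lambda lam c x * u x)"
  proof (rule Bochner_Integration.integrable_bound)
    show "integrable M\<^sub>\<Omega> (\<lambda>x. (lam + 1) * \<bar>c x\<bar> * C)" using Lp_int[OF Lc] by simp
    show "(\<lambda>x. c_lambda lam c x * u x) \<in> borel_measurable M\<^sub>\<Omega>"
      unfolding c_lambda_def pos_part_def neg_part_def by measurable
    show "AE x in M\<^sub>\<Omega>. norm (c_lambda lam c x * u x) \<le> norm ((lam + 1) * \<bar>c x\<bar> * C)"
      using C
    proof eventually_elim
      case (elim x)
      have "\<bar>c_lambda lam c x\<bar> \<le> (lam + 1) * \<bar>c x\<bar>"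
        using lam by (auto simp: c_lambda_def pos_part_def neg_part_def max_def abs_if algebra_simps mult_nonneg_nonpos)
      then have "\<bar>c_lambda lam c x * u x\<bar> \<le> (lam + 1) * \<bar>c x\<bar> * C"
        unfolding abs_mult[of "c_lambda lam c x"] using elim lam by (intro mult_mono) auto
      then show ?case by simp
    qed
  qed
  let ?\<psi> = "\<lambda>x. flat 1 ((U x - k) / s)"
  \<comment> \<open>On the left, each term pairs a fixed integrable function with the bounded weight
    of the i-th approximant; on the right, a fixed square integrable field is paired with its
    gradient.\<close>
  have limit: "(\<integral>x. c_lambda lam c x * u x * ?\<psi> x \<partial>M\<^sub>\<Omega>) + (\<integral>x. (M x *v G x) \<bullet> G x * ?\<psi> x \<partial>M\<^sub>\<Omega>)
      + (\<integral>x. h x * ?\<psi> x \<partial>M\<^sub>\<Omega>) \<le> 1 / s * (\<integral>x. flat (flat_deriv 1) ((U x - k) / s) * ((A x *v G x) \<bullet> V x) \<partial>M\<^sub>\<Omega>)"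
  proof (rule LIMSEQ_le[OF tendsto_add[OF tendsto_add[OF integral_flat_tendsto[OF cu_int] integral_flat_tendsto[OF MG_int]]
            integral_flat_tendsto[OF Lp_int[OF Lh]]]
          tendsto_mult[OF tendsto_const integral_flat_gradient_tendsto[OF _ AG_int]]])
    show "\<exists>N. \<forall>i\<ge>N. (\<integral>x. c_lambda lam c x * u x * flat 1 ((f i x - k) / s) \<partial>M\<^sub>\<Omega>)
       + (\<integral>x. (M x *v G x) \<bullet> G x * flat 1 ((f i x - k) / s) \<partial>M\<^sub>\<Omega>)
       + (\<integral>x. h x * flat 1 ((f i x - k) / s) \<partial>M\<^sub>\<Omega>)
       \<le> 1 / s * (\<integral>x. flat (flat_deriv 1) ((f i x - k) / s) * ((A x *v G x) \<bullet> g i x) \<partial>M\<^sub>\<Omega>)"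
    proof (intro exI allI impI)
      fix i
      have "(\<integral>x. (A x *v G x) \<bullet> ((flat (flat_deriv 1) ((f i x - k) / s) / s) *\<^sub>R g i x) \<partial>M\<^sub>\<Omega>) =
          (\<integral>x. 1 / s * (flat (flat_deriv 1) ((f i x - k) / s) * ((A x *v G x) \<bullet> g i x)) \<partial>M\<^sub>\<Omega>)"
        by (intro Bochner_Integration.integral_cong) auto
      then show "(\<integral>x. c_lambda lam c x * u x * flat 1 ((f i x - k) / s) \<partial>M\<^sub>\<Omega>)
       + (\<integral>x. (M x *v G x) \<bullet> G x * flat 1 ((f i x - k) / s) \<partial>M\<^sub>\<Omega>)
       + (\<integral>x. h x * flat 1 ((f i x - k) / s) \<partial>M\<^sub>\<Omega>)
       \<le> 1 / s * (\<integral>x. flat (flat_deriv 1) ((f i x - k) / s) * ((A x *v G x) \<bullet> g i x) \<partial>M\<^sub>\<Omega>)"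
        using super[OF test_fun_flat[OF test k s] flat_1_bounds(1) has_derivative_flat_affine[OF grad], of i]
        by (simp add: mult.commute)
    qed
  qed measurable
  have opp: "AE x in M\<^sub>\<Omega>. U x > 0 \<longrightarrow> G x = - V x"
    by (rule gradient_eq_on_negative_set[OF u])
  have U_pos: "U x > 0" if "(U x - k) / s > 0" for x
    using that k s by (auto simp: zero_less_divide_iff)
  have "(\<integral>x. flat (flat_deriv 1) ((U x - k) / s) * ((A x *v G x) \<bullet> V x) \<partial>M\<^sub>\<Omega>) \<le> 0"
  proof -
    have "AE x in M\<^sub>\<Omega>. 0 \<le> - (flat (flat_deriv 1) ((U x - k) / s) * ((A x *v G x) \<bullet> V x))"
      using opp AE_space
    proof eventually_elim
      case (elim x)
      show ?case
      proof (cases "(U x - k) / s > 0")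
        case True
        then have "G x = - V x" using elim U_pos by blast
        moreover have "x \<in> closure \<Omega>" using elim closure_subset by auto
        then have "0 \<le> V x \<bullet> (A x *v V x)"
          using A_low[of x "V x"] \<theta> by (meson mult_nonneg_nonneg less_imp_le order_trans zero_le_power2)
        moreover have "A x *v (- V x) = - (A x *v V x)"
          using matrix_vector_mult_diff_distrib[of "A x" 0 "V x"] by simp
        \<comment> \<open>\<open>flat_deriv 1\<close> is the monomial r^2, so \<psi> is
          nondecreasing.\<close>
        moreover have "0 \<le> flat (flat_deriv 1) ((U x - k) / s)"
          by (simp add: flat_def flat_deriv_def)
        ultimately show ?thesis by (simp add: inner_commute)
      qed simp
    qed
    then have "0 \<le> (\<integral>x. - (flat (flat_deriv 1) ((U x - k) / s) * ((A x *v G x) \<bullet> V x)) \<partial>M\<^sub>\<Omega>)"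
      by (rule integral_nonneg_AE)
    then show ?thesis by simp
  qed
  then have "1 / s * (\<integral>x. flat (flat_deriv 1) ((U x - k) / s) * ((A x *v G x) \<bullet> V x) \<partial>M\<^sub>\<Omega>) \<le> 0"
    using s by (simp add: divide_nonpos_pos)
  with limit have energy: "(\<integral>x. (M x *v G x) \<bullet> G x * ?\<psi> x \<partial>M\<^sub>\<Omega>) \<le>
      - (\<integral>x. c_lambda lam c x * u x * ?\<psi> x \<partial>M\<^sub>\<Omega>) - (\<integral>x. h x * ?\<psi> x \<partial>M\<^sub>\<Omega>)" by linarith
  have \<psi>: "?\<psi> \<in> borel_measurable M\<^sub>\<Omega>" "\<And>x. \<bar>?\<psi> x\<bar> \<le> 1" using flat_1_bounds by auto
  note \<psi>_int = integrable_mult_bounded[OF _ \<psi>]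
  have "\<mu>1 * \<theta> * (\<integral>x. ?\<psi> x * (norm (V x))\<^sup>2 \<partial>M\<^sub>\<Omega>) = (\<integral>x. \<mu>1 * \<theta> * ((norm (V x))\<^sup>2 * ?\<psi> x) \<partial>M\<^sub>\<Omega>)"
    by (simp add: mult.commute[of "?\<psi> _"])
  also have "\<dots> \<le> (\<integral>x. (M x *v G x) \<bullet> G x * ?\<psi> x \<partial>M\<^sub>\<Omega>)"
  proof (rule integral_mono_AE)
    show "AE x in M\<^sub>\<Omega>. \<mu>1 * \<theta> * ((norm (V x))\<^sup>2 * ?\<psi> x) \<le> (M x *v G x) \<bullet> G x * ?\<psi> x"
      using opp AE_space
    proof eventually_elim
      case (elim x)
      show ?case
      proof (cases "(U x - k) / s > 0")
        case True
        then have VG: "norm (V x) = norm (G x)" using elim U_pos by auto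
        have "\<mu>1 * \<theta> * (norm (V x))\<^sup>2 \<le> \<mu>1 * (norm (V x))\<^sup>2"
          using \<mu>1 \<theta>1 by (intro mult_right_mono) auto
        also have "\<dots> \<le> (M x *v G x) \<bullet> G x" using MG_bounds(1)[of x] elim by (simp add: VG)
        finally show ?thesis
          using mult_right_mono[OF _ flat_1_bounds(1)[of "(U x - k) / s"]] by (simp add: mult.assoc[symmetric])
      qed simp
    qed
  qed (use \<psi>_int[OF UV(4)] \<psi>_int[OF MG_int] in auto)
  also note energy
  also have "- (\<integral>x. c_lambda lam c x * u x * ?\<psi> x \<partial>M\<^sub>\<Omega>) - (\<integral>x. h x * ?\<psi> x \<partial>M\<^sub>\<Omega>) =
      (\<integral>x. - (c_lambda lam c x * u x * ?\<psi> x) - h x * ?\<psi> x \<partial>M\<^sub>\<Omega>)"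
    using \<psi>_int[OF cu_int] \<psi>_int[OF Lp_int[OF Lh]] by simp
  also have "\<dots> \<le> (\<integral>x. \<Lambda> * m * (indicator (superlevel k) x * \<bar>c x\<bar>) + indicator (superlevel k) x * \<bar>neg_part (h x)\<bar> \<partial>M\<^sub>\<Omega>)"
  proof (rule integral_mono_AE)
    show "AE x in M\<^sub>\<Omega>. - (c_lambda lam c x * u x * ?\<psi> x) - h x * ?\<psi> x \<le>
        \<Lambda> * m * (indicator (superlevel k) x * \<bar>c x\<bar>) + indicator (superlevel k) x * \<bar>neg_part (h x)\<bar>"
      using m(1) AE_space
    proof eventually_elim
      case (elim x)
      show ?case
      proof (cases "x \<in> superlevel k")
        case True
        then have pos: "U x > 0" using k by (simp add: superlevel_def)
        then have uU: "u x = - U x" by (auto simp: u(3) neg_part_def max_def split: if_splits)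
        \<comment> \<open>Since u = -U here, the part of the coefficient coming from
          \<open>c^-\<close> has the favourable sign and only an upper bound on
          \<open>c_lambda\<close> is required.\<close>
        have "c_lambda lam c x \<le> \<Lambda> * \<bar>c x\<bar>"
        proof -
          have "c_lambda lam c x \<le> lam * \<bar>c x\<bar>"
          proof (cases "c x \<ge> 0")
            case False
            then have "c_lambda lam c x = c x" by (simp add: c_lambda_def pos_part_def neg_part_def)
            also have "\<dots> \<le> lam * \<bar>c x\<bar>"
              using False lam mult_nonneg_nonneg[of lam "\<bar>c x\<bar>"] by simp
            finally show ?thesis .
          qed (simp add: c_lambda_def pos_part_def neg_part_def)
          also have "\<dots> \<le> \<Lambda> * \<bar>c x\<bar>" using lam by (intro mult_right_mono) auto
          finally show ?thesis .
        qed
        then have "c_lambda lam c x * U x \<le> \<Lambda> * \<bar>c x\<bar> * U x"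
          using pos by (intro mult_right_mono) auto
        also have "\<dots> \<le> \<Lambda> * \<bar>c x\<bar> * m" using elim lam by (intro mult_left_mono) auto
        finally have "- (c_lambda lam c x * u x) - h x \<le> \<Lambda> * m * \<bar>c x\<bar> + \<bar>neg_part (h x)\<bar>"
          by (simp add: uU neg_part_def mult_ac)
        \<comment> \<open>The expression it bounds may be negative; nonnegativity of the bound is
          what permits replacing the weight by 1.\<close>
        moreover have nn: "0 \<le> \<Lambda> * m * \<bar>c x\<bar> + \<bar>neg_part (h x)\<bar>" using lam m by auto
        ultimately have "(- (c_lambda lam c x * u x) - h x) * ?\<psi> x \<le> (\<Lambda> * m * \<bar>c x\<bar> + \<bar>neg_part (h x)\<bar>) * 1"
          using flat_1_bounds by (intro mult_mono) auto
        then show ?thesis using True by (simp add: algebra_simps)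
      next
        case False
        then show ?thesis using superlevel_flat[OF s _ False] elim by simp
      qed
    qed
  next
    show "integrable M\<^sub>\<Omega> (\<lambda>x. \<Lambda> * m * (indicator (superlevel k) x * \<bar>c x\<bar>) + indicator (superlevel k) x * \<bar>neg_part (h x)\<bar>)"
      using c_Holder(1) h_Holder(1) by simp
  qed (use \<psi>_int[OF cu_int] \<psi>_int[OF Lp_int[OF Lh]] in auto)
  also have "\<dots> \<le> (\<Lambda> * m * Lp_norm \<Omega> p c + Lp_norm \<Omega> p (\<lambda>x. neg_part (h x))) * measure M\<^sub>\<Omega> (superlevel k) powr (1 - 1 / p)"
  proof -
    have "\<Lambda> * m * (\<integral>x. indicator (superlevel k) x * \<bar>c x\<bar> \<partial>M\<^sub>\<Omega>) \<le>
        \<Lambda> * m * (Lp_norm \<Omega> p c * measure M\<^sub>\<Omega> (superlevel k) powr (1 - 1 / p))"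
      using c_Holder(2) lam m(2) by (intro mult_left_mono) (auto simp: Lp_norm_def)
    moreover have "(\<integral>x. indicator (superlevel k) x * \<bar>neg_part (h x)\<bar> \<partial>M\<^sub>\<Omega>) \<le>
        Lp_norm \<Omega> p (\<lambda>x. neg_part (h x)) * measure M\<^sub>\<Omega> (superlevel k) powr (1 - 1 / p)"
      unfolding Lp_norm_def by (rule h_Holder(2))
    ultimately show ?thesis
      using c_Holder(1) h_Holder(1) by (simp add: distrib_right mult.assoc)
  qed
  finally show ?thesis .
qed

text \<open>A bound \<open>m\<close> is improved to \<open>d\<close>, where d^2 has to exceed a
  multiple of 1 + m: for large \<open>m\<close> the new bound is of the order of its square root.
  The exponents 2/n from Faber-Krahn and 1 - 1/p from Hoelder add up to 1 + \<gamma>.\<close>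

lemma supremum_bound:
  fixes lam :: real
  assumes coeffs: "standing_coeffs \<Omega> p A \<theta> M \<mu>1 \<mu>2 c h" and p: "p > real CARD('n)" and lam: "lam \<in> {0..\<Lambda>}"
    and \<Omega>: "\<Omega> \<noteq> {}"
    and u: "H1_grad \<Omega> u G" "Linf \<Omega> u" "\<And>x. U x = neg_part (u x)"
    and super: "\<And>\<phi> g. test_fun \<Omega> \<phi> \<Longrightarrow> (\<And>x. 0 \<le> \<phi> x) \<Longrightarrow>
          (\<And>x. (\<phi> has_derivative (\<lambda>v. g x \<bullet> v)) (at x)) \<Longrightarrow>
          (\<integral>x. (A x *v G x) \<bullet> g x \<partial>M\<^sub>\<Omega>) \<ge>
            (\<integral>x. c_lambda lam c x * u x * \<phi> x \<partial>M\<^sub>\<Omega>)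
          + (\<integral>x. \<phi> x * ((M x *v G x) \<bullet> G x) \<partial>M\<^sub>\<Omega>)
          + (\<integral>x. h x * \<phi> x \<partial>M\<^sub>\<Omega>)"
    and m: "AE x in M\<^sub>\<Omega>. U x \<le> m" "m \<ge> 0"
  defines "\<gamma> \<equiv> 2 / CARD('n) - 1 / p"
  defines "E \<equiv> 4 * exp 2 * CARD('n) * 4 powr (2 / CARD('n)) *
    (\<Lambda> * Lp_norm \<Omega> p c + Lp_norm \<Omega> p (\<lambda>x. neg_part (h x))) / (\<mu>1 * \<theta>)"
  assumes d: "d > 0" "4 * (E * (1 + m)) * measure M\<^sub>\<Omega> \<Omega> powr \<gamma> * 4 powr (1 / \<gamma>) \<le> d\<^sup>2"
  shows "AE x in M\<^sub>\<Omega>. U x \<le> d"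
proof -
  let ?n = "real CARD('n)" and ?Kc = "Lp_norm \<Omega> p c" and ?Kh = "Lp_norm \<Omega> p (\<lambda>x. neg_part (h x))"
  have n: "?n \<ge> 1" by (simp add: Suc_leI)
  have p1: "p > 1" using p n by linarith
  have \<nu>: "\<mu>1 * \<theta> > 0" using coeffs by (auto simp: standing_coeffs_def)
  have K_nonneg: "?Kc \<ge> 0" "?Kh \<ge> 0" by (auto simp: Lp_norm_def)
  have \<Lambda>: "\<Lambda> \<ge> 0" using lam by auto
  have \<gamma>: "\<gamma> > 0"
  proof -
    have "1 / p < 1 / ?n" using p n by (intro divide_strict_left_mono) auto
    moreover have "1 / ?n \<le> 2 / ?n" by (intro divide_right_mono) auto
    ultimately show ?thesis unfolding \<gamma>_def by linarith
  qed
  have E: "E \<ge> 0" unfolding E_def using \<nu> K_nonneg \<Lambda> by (intro divide_nonneg_pos mult_nonneg_nonneg add_nonneg_nonneg) auto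
  have decay: "(h' - k)\<^sup>2 * measure M\<^sub>\<Omega> (superlevel h') \<le> E * (1 + m) * measure M\<^sub>\<Omega> (superlevel k) powr (1 + \<gamma>)"
    if k: "0 \<le> k" "k < h'" for k h'
  proof -
    define a where "a = measure M\<^sub>\<Omega> (superlevel k)"
    define J where "J = (\<integral>x. flat 1 ((U x - k) / (h' - k)) * (norm (V x))\<^sup>2 \<partial>M\<^sub>\<Omega>)"
    have a: "a \<ge> 0" by (simp add: a_def)
    have "\<mu>1 * \<theta> * J \<le> (\<Lambda> * m * ?Kc + ?Kh) * a powr (1 - 1 / p)"
      unfolding J_def a_def using k
      by (intro caccioppoli[OF coeffs p1 lam \<Omega> u super m]) auto
    \<comment> \<open>Factoring out 1 + m leaves a constant built from the data alone.\<close>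
    also have "\<dots> \<le> ((1 + m) * (\<Lambda> * ?Kc + ?Kh)) * a powr (1 - 1 / p)"
      using m(2) K_nonneg \<Lambda> by (intro mult_right_mono) (auto simp: algebra_simps)
    finally have J: "J \<le> (1 + m) * (\<Lambda> * ?Kc + ?Kh) * a powr (1 - 1 / p) / (\<mu>1 * \<theta>)"
      using \<nu> by (simp add: field_simps)
    have "(h' - k)\<^sup>2 * measure M\<^sub>\<Omega> (superlevel h') \<le> 4 * exp 2 * ?n * (4 * a) powr (2 / ?n) * J"
      unfolding J_def a_def by (rule level_set_estimate[OF k])
    also have "\<dots> \<le> 4 * exp 2 * ?n * (4 * a) powr (2 / ?n) * ((1 + m) * (\<Lambda> * ?Kc + ?Kh) * a powr (1 - 1 / p) / (\<mu>1 * \<theta>))"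
      using J by (intro mult_left_mono) auto
    also have "\<dots> = E * (1 + m) * (a powr (2 / ?n) * a powr (1 - 1 / p))"
      using a by (simp add: E_def powr_mult)
    also have "a powr (2 / ?n) * a powr (1 - 1 / p) = a powr (1 + \<gamma>)"
      by (simp add: \<gamma>_def algebra_simps flip: powr_add)
    finally show ?thesis unfolding a_def .
  qed
  have "measure M\<^sub>\<Omega> (superlevel d) = 0"
  proof (rule level_set_iteration[OF _ superlevel_antimono decay \<gamma> _ _ d])
    show "measure M\<^sub>\<Omega> (superlevel 0) \<le> measure M\<^sub>\<Omega> \<Omega>"
      by (intro finite_measure_mono) (auto simp: superlevel_def sets_restrict_space)
    show "0 \<le> E * (1 + m)" using E m by simp
  qed auto
  then have "superlevel d \<in> null_sets M\<^sub>\<Omega>"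
    by (intro null_setsI) (auto simp: emeasure_eq_measure)
  then have "AE x in M\<^sub>\<Omega>. x \<notin> superlevel d" by (rule AE_not_in)
  then show ?thesis using AE_space by eventually_elim (auto simp: superlevel_def not_less)
qed

end

section \<open>Closing the estimate: the constant in terms of the data\<close>

theorem theorem3p7:
  fixes \<Omega> :: "(real^'n) set" and p \<nu>1 \<Lambda>2 Kc Kh :: real
  assumes "CARD('n) \<ge> 3"
    and "bounded_domain \<Omega>" and "C1_Dini_boundary \<Omega>"
    and "p > real CARD('n)"
    and "\<Lambda>2 > 0"
  shows "\<exists>C::real. \<forall>A \<theta> M \<mu>1 \<mu>2 c h lam u.
           standing_coeffs \<Omega> p A \<theta> M \<mu>1 \<mu>2 c h \<longrightarrow>
           A_c_plus \<Omega> c \<longrightarrow>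
           \<mu>1 * \<theta> = \<nu>1 \<longrightarrow>
           Lp_norm \<Omega> p c = Kc \<longrightarrow>
           Lp_norm \<Omega> p (\<lambda>x. neg_part (h x)) = Kh \<longrightarrow>
           lam \<in> {0..\<Lambda>2} \<longrightarrow>
           supersolution \<Omega> A M c h lam u \<longrightarrow>
           Linf_norm \<Omega> (\<lambda>x. neg_part (u x)) \<le> C"
proof -
  have \<Omega>: "open \<Omega>" "bounded \<Omega>" "\<Omega> \<noteq> {}"
    using assms(2) by (auto simp: bounded_domain_def)
  define \<gamma> where "\<gamma> = 2 / CARD('n) - 1 / p"
  define E where "E = 4 * exp 2 * CARD('n) * 4 powr (2 / CARD('n)) * (\<Lambda>2 * Kc + Kh) / \<nu>1"
  \<comment> \<open>Up to the factor 1 + m, this is the threshold that the iteration starting from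
    level 0 imposes on d^2, with the measure of \<Omega> as initial value.\<close>
  define D where "D = 4 * E * measure (lebesgue_on \<Omega>) \<Omega> powr \<gamma> * 4 powr (1 / \<gamma>)"
  show ?thesis
  \<comment> \<open>The witness comes from L^2 \<le> D (2 + L) + 1 for the norm L: if L > 1, the
    right side is at most (3 D + 1) L.\<close>
  proof (intro exI[of _ "3 * D + 1"] allI impI)
    fix A :: "real^'n \<Rightarrow> real^'n^'n" and \<theta> and M :: "real^'n \<Rightarrow> real^'n^'n" and \<mu>1 \<mu>2 c h lam u
    assume coeffs: "standing_coeffs \<Omega> p A \<theta> M \<mu>1 \<mu>2 c h" and \<nu>1: "\<mu>1 * \<theta> = \<nu>1"
      and Kc: "Lp_norm \<Omega> p c = Kc" and Kh: "Lp_norm \<Omega> p (\<lambda>x. neg_part (h x)) = Kh"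
      and lam: "lam \<in> {0..\<Lambda>2}" and sol: "supersolution \<Omega> A M c h lam u"
    define U where "U x = neg_part (u x)" for x
    from sol have u_Linf: "Linf \<Omega> u" and "H10 \<Omega> U"
      by (auto simp: supersolution_def U_def[abs_def])
    from sol obtain G where G: "H1_grad \<Omega> u G"
      and super: "\<And>\<phi> g. test_fun \<Omega> \<phi> \<Longrightarrow> (\<And>x. 0 \<le> \<phi> x) \<Longrightarrow>
          (\<And>x. (\<phi> has_derivative (\<lambda>v. g x \<bullet> v)) (at x)) \<Longrightarrow>
          (\<integral>x. (A x *v G x) \<bullet> g x \<partial>lebesgue_on \<Omega>) \<ge>
            (\<integral>x. c_lambda lam c x * u x * \<phi> x \<partial>lebesgue_on \<Omega>)
          + (\<integral>x. \<phi> x * ((M x *v G x) \<bullet> G x) \<partial>lebesgue_on \<Omega>)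
          + (\<integral>x. h x * \<phi> x \<partial>lebesgue_on \<Omega>)"
      unfolding supersolution_def by blast
    \<comment> \<open>The gradient \<open>V\<close> obtained here and the gradient \<open>G\<close>
      of \<open>u\<close> are separate witnesses; \<open>gradient_eq_on_negative_set\<close> relates
      them where U > 0.\<close>
    obtain V f g H where "dominated_approximation \<Omega> U V f g H"
      using dominated_approximation_exists[OF \<Omega>(1,2) \<open>H10 \<Omega> U\<close>] by blast
    then interpret dominated_approximation \<Omega> U V f g H .
    have D: "D \<ge> 0"
    proof -
      have "Kc \<ge> 0" "Kh \<ge> 0" using Kc Kh by (auto simp: Lp_norm_def)
      moreover have "\<nu>1 > 0" using coeffs \<nu>1 by (auto simp: standing_coeffs_def)
      ultimately show ?thesis using assms(5) unfolding D_def E_def by simp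
    qed
    define L where "L = Linf_norm \<Omega> U"
    \<comment> \<open>The real infimum is meaningful only for a nonempty set bounded below.
      Nonemptiness comes from the boundedness of \<open>u\<close>, the lower bound 0 from the
      positive measure of \<Omega>.\<close>
    define S where "S = {C. AE x in lebesgue_on \<Omega>. \<bar>U x\<bar> \<le> C}"
    have L_Inf: "L = Inf S" by (simp add: L_def S_def Linf_norm_def)
    have S_nonneg: "C \<ge> 0" if "C \<in> S" for C
    proof (rule ccontr)
      assume "\<not> C \<ge> 0"
      with that have "AE x in lebesgue_on \<Omega>. False" unfolding S_def by (auto elim!: eventually_mono)
      then have "emeasure (lebesgue_on \<Omega>) (space (lebesgue_on \<Omega>)) = 0"
        by (simp add: AE_iff_measurable[of "space (lebesgue_on \<Omega>)"])
      then have "emeasure lebesgue \<Omega> = 0" using \<Omega>_sets by (simp add: emeasure_restrict_space)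
      then have "negligible \<Omega>" using \<Omega>_sets by (simp add: negligible_iff_null_sets null_setsI)
      then show False using open_not_negligible[OF \<Omega>(1,3)] by simp
    qed
    have S_ne: "S \<noteq> {}"
    proof -
      obtain C where "AE x in lebesgue_on \<Omega>. \<bar>u x\<bar> \<le> C" using u_Linf by (auto simp: Linf_def)
      then have "AE x in lebesgue_on \<Omega>. \<bar>U x\<bar> \<le> C"
        by eventually_elim (auto simp: U_def neg_part_def)
      then show ?thesis by (auto simp: S_def)
    qed
    have L0: "L \<ge> 0" unfolding L_Inf using S_ne S_nonneg by (intro cInf_greatest) auto
    \<comment> \<open>Taking L + 1 as the a priori bound avoids proving that the infimum is
      attained.\<close>
    have "Inf S < L + 1" by (simp add: L_Inf)
    then obtain C where C: "C \<in> S" "C < L + 1" using cInf_lessD[OF S_ne] by blast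
    then have U_le: "AE x in lebesgue_on \<Omega>. U x \<le> L + 1"
      unfolding S_def by (auto elim!: eventually_mono)
    \<comment> \<open>The threshold for m = L + 1 is D (2 + L); the added 1 keeps \<open>d\<close>
      positive even when D = 0.\<close>
    define d where "d = sqrt (D * (2 + L) + 1)"
    have d: "d > 0" "d\<^sup>2 = D * (2 + L) + 1"
      using D L0 by (auto simp: d_def intro: add_nonneg_pos)
    have "AE x in lebesgue_on \<Omega>. U x \<le> d"
    proof (rule supremum_bound[OF coeffs assms(4) lam \<Omega>(3) G u_Linf U_def super U_le])
      have "4 * (E * (1 + (L + 1))) * measure (lebesgue_on \<Omega>) \<Omega> powr \<gamma> * 4 powr (1 / \<gamma>) = D * (2 + L)"
        by (simp add: D_def algebra_simps)
      then show "4 * (4 * exp 2 * real CARD('n) * 4 powr (2 / real CARD('n)) *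
          (\<Lambda>2 * Lp_norm \<Omega> p c + Lp_norm \<Omega> p (\<lambda>x. neg_part (h x))) / (\<mu>1 * \<theta>) * (1 + (L + 1))) *
          measure (lebesgue_on \<Omega>) \<Omega> powr (2 / real CARD('n) - 1 / p) * 4 powr (1 / (2 / real CARD('n) - 1 / p)) \<le> d\<^sup>2"
        unfolding d(2) Kc Kh \<nu>1 E_def \<gamma>_def by linarith
    qed (use d L0 in auto)
    then have "AE x in lebesgue_on \<Omega>. \<bar>U x\<bar> \<le> d"
      by eventually_elim (auto simp: U_def neg_part_def)
    then have "d \<in> S" by (simp add: S_def)
    then have "L \<le> d"
      unfolding L_Inf using S_nonneg by (intro cInf_lower) (auto simp: bdd_below_def)
    then have "L\<^sup>2 \<le> D * (2 + L) + 1" using L0 power_mono[of L d 2] d(2) by simp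
    then have "L \<le> 3 * D + 1"
    proof (cases "L \<le> 1")
      case False
      have "L * L \<le> D * (2 + L) + 1" using \<open>L\<^sup>2 \<le> D * (2 + L) + 1\<close> by (simp add: power2_eq_square)
      also have "\<dots> \<le> D * (3 * L) + L" using False D by (intro add_mono mult_left_mono) auto
      finally have "L * L \<le> (3 * D + 1) * L" by (simp add: algebra_simps)
      then show ?thesis using False by simp
    qed (use D in linarith)
    then show "Linf_norm \<Omega> (\<lambda>x. neg_part (u x)) \<le> 3 * D + 1"
      by (simp add: L_def U_def[abs_def])
  qed
qed

end
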